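(* Consider the downlink of a multi-cell Massive MIMO system with $L$ cells and $K$ single-antenna users per cell, operating in coherence intervals of $\tau_c$ symbols, of which $\tau_p$ are used for uplink pilots and $\tau_c-\tau_p$ for downlink data. The received downlink signal at user $k$ in cell $l$ is $$y_{lk}[n]=\sum_{l'=1}^{L}\sum_{k'=1}^{K}\sqrt{\eta_{l'k'}}\,\alpha_{lk}^{l'k'}\,s_{l'k'}[n]+\tilde w_{lk}[n],\qquad n=1,\dots,\tau_c-\tau_p .$$ Let $\bar\alpha_{lk}^{lk}[n]$ be the estimate of the effective channel gain $\alpha_{lk}^{lk}$ that is used for the $n$-th data symbol and is computed from the sample average power $$\xi'_{lk}[n]=\frac{1}{\tau_c-\tau_p-1}\sum_{n'=1,\,n'\neq n}^{\tau_c-\tau_p}|y_{lk}[n']|^2,$$ that is, $\bar\alpha_{lk}^{lk}[n]=\sqrt{(\xi'_{lk}[n]-T_{lk})/\eta_{lk}}$ if $\xi'_{lk}[n]>\Theta_{lk}$ and $\bar\alpha_{lk}^{lk}[n]=\mathbb E\{\alpha_{lk}^{lk}\}$ otherwise. Then a downlink ergodic spectral efficiency for user $k$ in cell $l$ (achievable in the sense that it is a lower bound on the ergodic channel capacity) is $$\mathrm R_{lk}=\Bigl(1-\frac{\tau_p}{\tau_c}\Bigr)\log_2\bigl(1+\mathrm{SINR}_{lk}\bigr)\quad\text{[b/s/Hz]},$$ where the effective downlink signal-to-interference-and-noise ratio is $$\mathrm{SINR}_{lk}=\frac{\left|\mathbb E\left\{\frac{\alpha_{lk}^{lk}}{\bar\alpha_{lk}^{lk}[n]}\right\}\right|^2}{\mathrm{var}\left\{\frac{\alpha_{lk}^{lk}}{\bar\alpha_{lk}^{lk}[n]}\right\}+\sum\limits_{\substack{k'=1\\k'\neq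 k}}^{K}\frac{\eta_{lk'}}{\eta_{lk}}\mathbb E\left\{\left|\frac{\alpha_{lk}^{lk'}}{\bar\alpha_{lk}^{lk}[n]}\right|^2\right\}+\sum\limits_{\substack{l'=1\\l'\neq l}}^{L}\sum\limits_{k'=1}^{K}\frac{\eta_{l'k'}}{\eta_{lk}}\mathbb E\left\{\left|\frac{\alpha_{lk}^{l'k'}}{\bar\alpha_{lk}^{lk}[n]}\right|^2\right\}+\frac{\sigma_{\mathrm{DL}}^2}{\eta_{lk}}\mathbb E\left\{\frac{1}{|\bar\alpha_{lk}^{lk}[n]|^2}\right\}}.$$
   Context: $\mathbf g_{lk}^{l'}\in\mathbb C^M$ is the channel between the $M$-antenna base station (BS) $l'$ and user $k$ in cell $l$. It follows correlated Rayleigh fading, $\mathbf g_{lk}^{l'}\sim\mathcal{CN}(\mathbf 0,\mathbf R_{lk}^{l'})$ with positive semi-definite spatial correlation matrix $\mathbf R_{lk}^{l'}$. The channels are constant within a coherence interval and change independently from one coherence interval to the next according to a stationary ergodic random process. $\mathbf w_{l'k'}\in\mathbb C^M$ is the linear precoding vector that BS $l'$ assigns to its user $k'$, formed from BS $l'$'s channel estimates obtained from the uplink pilots and from the channel statistics. The effective downlink channel gains are $\alpha_{lk}^{l'k'}=\sqrt{\rho_{\rm dl}}\,(\mathbf g_{lk}^{l'})^{\rm H}\mathbf w_{l'k'}$, where $\rho_{\rm dl}$ is the maximum downlink transmit power. The $\eta_{l'k'}\in[0,1]$ are fixed power allocation coefficients with $\sum_{k'=1}^{K}\eta_{l'k'}\le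 1$ for every cell $l'$. The data symbols $s_{l'k'}[n]$ have zero mean and unit power, $\mathbb E\{|s_{l'k'}[n]|^2\}=1$, and are i.i.d. over $n$. The noise is $\tilde w_{lk}[n]\sim\mathcal{CN}(0,\sigma_{\mathrm{DL}}^2)$. Signals and noise are mutually independent. $T_{lk}=\sum_{k'\neq k}\eta_{lk'}\mathbb E\{|\alpha_{lk}^{lk'}|^2\}+\sum_{l'\ne l}\sum_{k'=1}^{K}\eta_{l'k'}\mathbb E\{|\alpha_{lk}^{l'k'}|^2\}+\sigma_{\mathrm{DL}}^2$, and $\Theta_{lk}$ is a switching point with value above $T_{lk}$. It is assumed that the user can compute the average equalized gain $\mathbb E\{\alpha_{lk}^{lk}/\bar\alpha_{lk}^{lk}[n]\}$, which is constant over long time and the same for all $n$ because the data symbols are i.i.d., as well as the other long-term statistics used here. The spectral efficiency is obtained by dividing $y_{lk}[n]$ by $\sqrt{\eta_{lk}}\,\bar\alpha_{lk}^{lk}[n]$, taking $\mathbb E\{\alpha_{lk}^{lk}/\bar\alpha_{lk}^{lk}[n]\}\,s_{lk}[n]$ as the desired signal with a deterministic gain, and treating all remaining terms (the gain deviation times $s_{lk}[n]$, intra-cell interference, inter-cell interference and noise) as additive noise in a standard capacity lower bound.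
   Formalization: For general data symbols, the spectral efficiency is bounded by the sum of the capacities of the per-symbol channels; the bound by the capacity with joint coding over all data symbols is stated only for CN(0,1) symbols of the user, since it fails for e.g. constant-modulus symbols. *)

theory Defs
  imports "HOL-Probability.Probability"
begin

section \<open>Circularly symmetric complex Gaussian laws\<close>

definition cinner :: "complex ^ 'm \<Rightarrow> complex ^ 'm \<Rightarrow> complex"
  where "cinner x y = (\<Sum>i\<in>UNIV. cnj (x $ i) * y $ i)"

definition psd :: "complex ^ 'm ^ 'm \<Rightarrow> bool"
  where "psd R \<longleftrightarrow> (\<forall>a. cinner a (R *v a) \<in> \<real> \<and> 0 \<le> Re (cinner a (R *v a)))"

definition cn_law :: "real \<Rightarrow> complex measure"
  where "cn_law v =
    (if v = 0 then return borel 0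
     else density lborel (\<lambda>z. ennreal (exp (- (norm z)\<^sup>2 / v) / (pi * v))))"

text \<open>A vector has law \<open>CN(0,R)\<close> when each \<open>a\<^sup>H g\<close> has law \<open>CN(0, a\<^sup>H R a)\<close>; this form also covers
  singular \<open>R\<close>, for which there is no density.\<close>

definition cn_vector :: "'w measure \<Rightarrow> ('w \<Rightarrow> complex ^ 'm) \<Rightarrow> complex ^ 'm ^ 'm \<Rightarrow> bool"
  where "cn_vector M g R \<longleftrightarrow>
    g \<in> borel_measurable M \<and>
    (\<forall>a. distr M borel (\<lambda>\<omega>. cinner a (g \<omega>)) = cn_law (Re (cinner a (R *v a))))"

definition cvar :: "'w measure \<Rightarrow> ('w \<Rightarrow> complex) \<Rightarrow> real"
  where "cvar M X = (\<integral>\<omega>. (norm (X \<omega> - (\<integral>\<omega>'. X \<omega>' \<partial>M)))\<^sup>2 \<partial>M)"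


section \<open>Signal model\<close>

text \<open>Cells are the elements of \<open>'c\<close>, the users of each cell those of \<open>'u\<close>, the antennas those of \<open>'m\<close>.
  The first index \<open>t\<close> counts coherence intervals, and \<open>n \<in> {1..tauc - taup}\<close> the downlink
  data symbols inside one interval. In \<open>chan S t \<omega> $ l' $ l $ k\<close> the base station is \<open>l'\<close> and the
  receiver is user \<open>k\<close> of cell \<open>l\<close>; \<open>est S t \<omega> $ l' $ l $ k\<close> is the estimate of this vector that base
  station \<open>l'\<close> has obtained from the uplink pilots of interval \<open>t\<close>. The map \<open>precoder S l' k'\<close> is
  deterministic, so it may use the channel statistics.\<close>

record ('w, 'c::finite, 'u::finite, 'm::finite) downlink =
  Om :: "'w measure"
  chan :: "nat \<Rightarrow> 'w \<Rightarrow> complex ^ 'm ^ 'u ^ 'c ^ 'c"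
  est :: "nat \<Rightarrow> 'w \<Rightarrow> complex ^ 'm ^ 'u ^ 'c ^ 'c"
  Rcov :: "'c \<Rightarrow> 'c \<Rightarrow> 'u \<Rightarrow> complex ^ 'm ^ 'm"
  precoder :: "'c \<Rightarrow> 'u \<Rightarrow> complex ^ 'm ^ 'u ^ 'c \<Rightarrow> complex ^ 'm"
  symb :: "nat \<Rightarrow> 'c \<Rightarrow> 'u \<Rightarrow> nat \<Rightarrow> 'w \<Rightarrow> complex"
  noise :: "nat \<Rightarrow> 'c \<Rightarrow> 'u \<Rightarrow> nat \<Rightarrow> 'w \<Rightarrow> complex"
  rho :: real
  eta :: "'c \<Rightarrow> 'u \<Rightarrow> real"
  sigma2 :: real
  tauc :: nat
  taup :: nat
  Theta :: "'c \<Rightarrow> 'u \<Rightarrow> real"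

definition data_idx :: "('w, 'c::finite, 'u::finite, 'm::finite) downlink \<Rightarrow> nat set"
  where "data_idx S = {1..tauc S - taup S}"

definition prec_vec ::
    "('w, 'c::finite, 'u::finite, 'm::finite) downlink \<Rightarrow> nat \<Rightarrow> 'c \<Rightarrow> 'u \<Rightarrow> 'w \<Rightarrow> complex ^ 'm"
  where "prec_vec S t l' k' \<omega> = precoder S l' k' (est S t \<omega> $ l')"

definition alpha ::
    "('w, 'c::finite, 'u::finite, 'm::finite) downlink \<Rightarrow> nat \<Rightarrow> 'c \<Rightarrow> 'u \<Rightarrow> 'c \<Rightarrow> 'u \<Rightarrow> 'w \<Rightarrow> complex"
  where "alpha S t l k l' k' \<omega> =
    complex_of_real (sqrt (rho S)) * cinner (chan S t \<omega> $ l' $ l $ k) (prec_vec S t l' k' \<omega>)"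

definition received ::
    "('w, 'c::finite, 'u::finite, 'm::finite) downlink \<Rightarrow> 'c \<Rightarrow> 'u \<Rightarrow> nat \<Rightarrow> nat \<Rightarrow>
      ('c \<Rightarrow> 'u \<Rightarrow> complex) \<Rightarrow> 'w \<Rightarrow> complex"
  where "received S l k t n c \<omega> =
    (\<Sum>l'\<in>UNIV. \<Sum>k'\<in>UNIV. complex_of_real (sqrt (eta S l' k')) * alpha S t l k l' k' \<omega> * c l' k')
      + noise S t l k n \<omega>"

definition y_lk ::
    "('w, 'c::finite, 'u::finite, 'm::finite) downlink \<Rightarrow> 'c \<Rightarrow> 'u \<Rightarrow> nat \<Rightarrow> nat \<Rightarrow> 'w \<Rightarrow> complex"
  where "y_lk S l k t n \<omega> = received S l k t n (\<lambda>l' k'. symb S t l' k' n \<omega>) \<omega>"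

definition xi_lk ::
    "('w, 'c::finite, 'u::finite, 'm::finite) downlink \<Rightarrow> 'c \<Rightarrow> 'u \<Rightarrow> nat \<Rightarrow> nat \<Rightarrow> 'w \<Rightarrow> real"
  where "xi_lk S l k t n \<omega> =
    1 / (real (tauc S) - real (taup S) - 1) * (\<Sum>n'\<in>data_idx S - {n}. (norm (y_lk S l k t n' \<omega>))\<^sup>2)"

definition T_lk ::
    "('w, 'c::finite, 'u::finite, 'm::finite) downlink \<Rightarrow> 'c \<Rightarrow> 'u \<Rightarrow> nat \<Rightarrow> real"
  where "T_lk S l k t =
    (\<Sum>k'\<in>UNIV - {k}. eta S l k' * (\<integral>\<omega>. (norm (alpha S t l k l k' \<omega>))\<^sup>2 \<partial>Om S))
    + (\<Sum>l'\<in>UNIV - {l}. \<Sum>k'\<in>UNIV. eta S l' k' * (\<integral>\<omega>. (norm (alpha S t l k l' k' \<omega>))\<^sup>2 \<partial>Om S))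
    + sigma2 S"

definition alpha_bar ::
    "('w, 'c::finite, 'u::finite, 'm::finite) downlink \<Rightarrow> 'c \<Rightarrow> 'u \<Rightarrow> nat \<Rightarrow> nat \<Rightarrow> 'w \<Rightarrow> complex"
  where "alpha_bar S l k t n \<omega> =
    (if xi_lk S l k t n \<omega> > Theta S l k
     then complex_of_real (sqrt ((xi_lk S l k t n \<omega> - T_lk S l k t) / eta S l k))
     else (\<integral>\<omega>'. alpha S t l k l k \<omega>' \<partial>Om S))"


section \<open>Standing assumptions\<close>

datatype ('c, 'u) source = Channel nat | Symbol nat 'c 'u nat | Noise nat 'c 'u nat

definition sources :: "('w, 'c::finite, 'u::finite, 'm::finite) downlink \<Rightarrow> ('c, 'u) source set"
  where "sources S =
    range Channel
    \<union> {Symbol t l k n | t l k n. n \<in> data_idx S}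
    \<union> {Noise t l k n | t l k n. n \<in> data_idx S}"

fun source_events ::
    "('w, 'c::finite, 'u::finite, 'm::finite) downlink \<Rightarrow> ('c, 'u) source \<Rightarrow> 'w set set"
  where
    "source_events S (Channel t) =
      sets (vimage_algebra (space (Om S)) (\<lambda>\<omega>. (chan S t \<omega>, est S t \<omega>)) borel)"
  | "source_events S (Symbol t l k n) =
      sets (vimage_algebra (space (Om S)) (symb S t l k n) borel)"
  | "source_events S (Noise t l k n) =
      sets (vimage_algebra (space (Om S)) (noise S t l k n) borel)"

text \<open>The coherence intervals are independent and identically distributed, the
  stationary ergodic block-fading process of the model. Inside one interval, channels and estimates
  may be dependent in any way. Square integrability of the gains is what makes \<^const>\<open>T_lk\<close> and the
  moments of the equalized gains meaningful.\<close>

locale mimo_downlink = prob_space "Om S"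
  for S :: "('w, 'c::finite, 'u::finite, 'm::finite) downlink" +
  assumes chan_measurable: "\<And>t. chan S t \<in> borel_measurable (Om S)"
    and est_measurable: "\<And>t. est S t \<in> borel_measurable (Om S)"
    and precoder_measurable: "\<And>l k. precoder S l k \<in> borel_measurable borel"
    and symb_measurable: "\<And>t l k n. n \<in> data_idx S \<Longrightarrow> symb S t l k n \<in> borel_measurable (Om S)"
    and noise_measurable: "\<And>t l k n. n \<in> data_idx S \<Longrightarrow> noise S t l k n \<in> borel_measurable (Om S)"
    and sources_indep: "indep_sets (source_events S) (sources S)"
    and chan_stationary:
      "\<And>t t'. distr (Om S) borel (\<lambda>\<omega>. (chan S t \<omega>, est S t \<omega>))
             = distr (Om S) borel (\<lambda>\<omega>. (chan S t' \<omega>, est S t' \<omega>))"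
    and Rcov_psd: "\<And>l' l k. psd (Rcov S l' l k)"
    and rayleigh: "\<And>t l' l k. cn_vector (Om S) (\<lambda>\<omega>. chan S t \<omega> $ l' $ l $ k) (Rcov S l' l k)"
    and alpha_square_integrable:
      "\<And>t l k l' k'. integrable (Om S) (\<lambda>\<omega>. (norm (alpha S t l k l' k' \<omega>))\<^sup>2)"
    and symb_identical:
      "\<And>t t' l k n n'. n \<in> data_idx S \<Longrightarrow> n' \<in> data_idx S \<Longrightarrow>
        distr (Om S) borel (symb S t l k n) = distr (Om S) borel (symb S t' l k n')"
    and symb_mean: "\<And>t l k n. n \<in> data_idx S \<Longrightarrow> (\<integral>\<omega>. symb S t l k n \<omega> \<partial>Om S) = 0"
    and symb_power: "\<And>t l k n. n \<in> data_idx S \<Longrightarrow> (\<integral>\<omega>. (norm (symb S t l k n \<omega>))\<^sup>2 \<partial>Om S) = 1"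
    and noise_law: "\<And>t l k n. n \<in> data_idx S \<Longrightarrow> distr (Om S) borel (noise S t l k n) = cn_law (sigma2 S)"
    and sigma2_pos: "0 < sigma2 S"
    and rho_pos: "0 < rho S"
    and eta_range: "\<And>l k. 0 \<le> eta S l k \<and> eta S l k \<le> 1"
    and eta_sum: "\<And>l. (\<Sum>k\<in>UNIV. eta S l k) \<le> 1"
    and tau: "taup S + 2 \<le> tauc S"
    and Theta_above: "\<And>l k t. T_lk S l k t < Theta S l k"


section \<open>Spectral efficiency expression\<close>

definition SINR ::
    "('w, 'c::finite, 'u::finite, 'm::finite) downlink \<Rightarrow> 'c \<Rightarrow> 'u \<Rightarrow> nat \<Rightarrow> nat \<Rightarrow> real"
  where "SINR S l k t n =
    (norm (\<integral>\<omega>. alpha S t l k l k \<omega> / alpha_bar S l k t n \<omega> \<partial>Om S))\<^sup>2 /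
    (cvar (Om S) (\<lambda>\<omega>. alpha S t l k l k \<omega> / alpha_bar S l k t n \<omega>)
     + (\<Sum>k'\<in>UNIV - {k}. eta S l k' / eta S l k *
          (\<integral>\<omega>. (norm (alpha S t l k l k' \<omega> / alpha_bar S l k t n \<omega>))\<^sup>2 \<partial>Om S))
     + (\<Sum>l'\<in>UNIV - {l}. \<Sum>k'\<in>UNIV. eta S l' k' / eta S l k *
          (\<integral>\<omega>. (norm (alpha S t l k l' k' \<omega> / alpha_bar S l k t n \<omega>))\<^sup>2 \<partial>Om S))
     + sigma2 S / eta S l k * (\<integral>\<omega>. 1 / (norm (alpha_bar S l k t n \<omega>))\<^sup>2 \<partial>Om S))"

definition SE ::
    "('w, 'c::finite, 'u::finite, 'm::finite) downlink \<Rightarrow> 'c \<Rightarrow> 'u \<Rightarrow> nat \<Rightarrow> nat \<Rightarrow> real"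
  where "SE S l k t n = (1 - real (taup S) / real (tauc S)) * log 2 (1 + SINR S l k t n)"


section \<open>Ergodic capacity\<close>

text \<open>Mutual information in bits. \<^const>\<open>KL_divergence\<close> is a Bochner integral and carries no information
  when the divergence is infinite, hence the case distinction. Since the negative part of
  the information density is always integrable, failure of integrability means \<open>\<infinity>\<close>.\<close>

definition mutual_info ::
    "'p measure \<Rightarrow> 'a measure \<Rightarrow> 'b measure \<Rightarrow> ('p \<Rightarrow> 'a) \<Rightarrow> ('p \<Rightarrow> 'b) \<Rightarrow> ereal"
  where "mutual_info P A B X Y =
    (let Q = distr P A X \<Otimes>\<^sub>M distr P B Y; J = distr P (A \<Otimes>\<^sub>M B) (\<lambda>\<omega>. (X \<omega>, Y \<omega>))
     in if absolutely_continuous Q J \<and> integrable J (entropy_density 2 Q J)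
        then ereal (KL_divergence 2 Q J) else \<infinity>)"

abbreviation signals :: "(nat \<times> nat) set \<Rightarrow> (nat \<times> nat \<Rightarrow> complex) measure"
  where "signals I \<equiv> PiM I (\<lambda>_. borel)"

definition input_laws :: "(nat \<times> nat) set \<Rightarrow> (nat \<times> nat \<Rightarrow> complex) measure set"
  where "input_laws I = {\<mu>. prob_space \<mu> \<and> sets \<mu> = sets (signals I) \<and>
    (\<integral>\<^sup>+ x. (\<Sum>i\<in>I. ennreal ((norm (x i))\<^sup>2)) \<partial>\<mu>) \<le> of_nat (card I)}"

text \<open>Received signal when the data symbols of user \<open>k\<close> in cell \<open>l\<close> at the positions \<open>A\<close> of each
  coherence interval are replaced by a channel input \<open>x\<close>; every other symbol keeps its own law.\<close>

definition y_input ::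
    "('w, 'c::finite, 'u::finite, 'm::finite) downlink \<Rightarrow> 'c \<Rightarrow> 'u \<Rightarrow> nat set \<Rightarrow>
      (nat \<times> nat \<Rightarrow> complex) \<Rightarrow> nat \<times> nat \<Rightarrow> 'w \<Rightarrow> complex"
  where "y_input S l k A x = (\<lambda>(t, n) \<omega>.
    received S l k t n
      (\<lambda>l' k'. if l' = l \<and> k' = k \<and> n \<in> A then x (t, n) else symb S t l' k' n \<omega>) \<omega>)"

text \<open>Ergodic capacity, in bits per symbol of the coherence interval, of the channel whose inputs are
  the symbols at the positions \<open>A\<close> and whose outputs are all received samples: the limiting
  mutual information rate over many coherence intervals, maximized over the input laws of at most
  unit average power. The input is independent of channels, estimates, noise and
  all other symbols (product measure), and the receiver has no channel knowledge
  beyond the received samples. With \<open>A = data_idx S\<close> this is the capacity of the whole downlink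
  channel to the user, coded jointly over all data symbols. With \<open>A = {n}\<close> it is the
  channel seen by the \<open>n\<close>-th data symbol alone, coded across coherence intervals, where the other
  data symbols of the user are just random with their given law.\<close>

definition ergodic_capacity ::
    "('w, 'c::finite, 'u::finite, 'm::finite) downlink \<Rightarrow> 'c \<Rightarrow> 'u \<Rightarrow> nat set \<Rightarrow> ereal"
  where "ergodic_capacity S l k A =
    liminf (\<lambda>N. ereal (1 / (real N * real (tauc S))) *
      (SUP \<mu>\<in>input_laws ({..<N} \<times> A).
        mutual_info (\<mu> \<Otimes>\<^sub>M Om S) (signals ({..<N} \<times> A)) (signals ({..<N} \<times> data_idx S))
          fst (\<lambda>(x, \<omega>). \<lambda>i\<in>{..<N} \<times> data_idx S. y_input S l k A x i \<omega>)))"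

end

theory Submission
  imports Defs
begin

text \<open>
  For every positive \<open>f\<close> with \<open>\<integral> f d(P\<^sub>X \<otimes> P\<^sub>Y) \<le> 1\<close>, the inequality \<open>ln t \<le> t - 1\<close> gives
  \<open>I(X;Y) \<ge> E[log f(X,Y)]\<close>. Take i.i.d. \<open>CN(0,1)\<close> inputs \<open>x\<^sub>i\<close> and let \<open>z\<^sub>i\<close> be the sample \<open>y\<^sub>i\<close>
  divided by \<open>sqrt \<eta>\<close> times the gain estimate, a function of the output. Let \<open>f\<close> be the product over
  \<open>i\<close> of the density of \<open>CN(c z\<^sub>i, s)\<close> relative to \<open>CN(0,1)\<close>, with \<open>c\<close> the linear MMSE
  coefficient and \<open>s = E|x\<^sub>i - c z\<^sub>i|\<^sup>2\<close> the error power. The bound becomes \<open>- log s\<close> per input.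

  The gain estimate for symbol \<open>n\<close> depends only on the channels and on the symbols and noise at
  the other positions, so it is independent of the symbols and the noise at position \<open>n\<close>. Hence
  \<open>x\<^sub>i - c z\<^sub>i\<close> is an orthogonal sum, and its power is \<open>s = 1 / (1 + SINR)\<close>. By stationarity
  and exchangeability of the positions, \<open>SINR\<close> does not depend on the interval or on \<open>n\<close>.
\<close>

declare One_nat_def [simp del]

section \<open>The circularly symmetric complex Gaussian law\<close>

lemma cn_density_eq_prod:
  fixes z :: complex
  assumes "0 < v"
  shows "exp (- (norm z)\<^sup>2 / v) / (pi * v) = normal_density 0 (sqrt (v/2)) (Re z) * normal_density 0 (sqrt (v/2)) (Im z)"
  using assms by (simp add: normal_density_def real_sqrt_mult[symmetric] cmod_power2 exp_add[symmetric] field_simps)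

lemma nn_integral_lborel_complex_prod:
  fixes f g :: "real \<Rightarrow> ennreal"
  assumes [measurable]: "f \<in> borel_measurable borel" "g \<in> borel_measurable borel"
  shows "(\<integral>\<^sup>+z. f (Re z) * g (Im z) \<partial>lborel) = (\<integral>\<^sup>+x. f x \<partial>lborel) * (\<integral>\<^sup>+x. g x \<partial>lborel)"
proof -
  define h where "h b = (if b = 1 then f else g)" for b :: complex
  have "(\<integral>\<^sup>+z. (\<Prod>b\<in>Basis. h b (z \<bullet> b)) \<partial>lborel) = (\<Prod>b\<in>Basis. (\<integral>\<^sup>+x. h b x \<partial>lborel))"
    by (rule nn_integral_lborel_prod) (auto simp: h_def)
  then show ?thesis
    by (simp add: h_def Basis_complex_def inner_complex_def)
qed

lemma sets_cn_law [measurable_cong, simp]: "sets (cn_law v) = sets borel"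
  by (simp add: cn_law_def)

lemma nn_integral_cn_density:
  fixes a :: complex
  assumes "0 < v"
  shows "(\<integral>\<^sup>+z. ennreal (exp (- (norm (z - a))\<^sup>2 / v) / (pi * v)) \<partial>lborel) = 1"
proof -
  have n: "(\<integral>\<^sup>+x. ennreal (normal_density 0 (sqrt (v/2)) x) \<partial>lborel) = 1"
    using prob_space.emeasure_space_1[OF prob_space_normal_density[of "sqrt (v/2)" 0]] assms
    by (simp add: emeasure_density)
  have "(\<integral>\<^sup>+z. ennreal (exp (- (norm (z - a))\<^sup>2 / v) / (pi * v)) \<partial>lborel)
    = (\<integral>\<^sup>+z. ennreal (exp (- (norm (z - a))\<^sup>2 / v) / (pi * v)) \<partial>distr lborel borel ((+) a))"
    by (simp add: lborel_distr_plus)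
  also have "\<dots> = (\<integral>\<^sup>+z. ennreal (exp (- (norm z)\<^sup>2 / v) / (pi * v)) \<partial>(lborel::complex measure))"
    by (subst nn_integral_distr) auto
  also have "\<dots> = (\<integral>\<^sup>+z. ennreal (normal_density 0 (sqrt (v/2)) (Re z)) * ennreal (normal_density 0 (sqrt (v/2)) (Im z)) \<partial>lborel)"
    unfolding cn_density_eq_prod[OF assms] by (simp add: ennreal_mult)
  also have "\<dots> = 1"
    by (subst nn_integral_lborel_complex_prod) (auto simp: n)
  finally show ?thesis .
qed

lemma prob_space_cn_law:
  assumes "0 < v"
  shows "prob_space (cn_law v)"
  using assms nn_integral_cn_density[OF assms, of 0]
  by (intro prob_spaceI) (simp add: cn_law_def emeasure_density)

lemma nn_integral_cn_law_power2:
  assumes "0 < v"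
  shows "(\<integral>\<^sup>+z. ennreal ((norm z)\<^sup>2) \<partial>cn_law v) = ennreal v"
proof -
  let ?n = "normal_density 0 (sqrt (v/2))"
  have n: "(\<integral>\<^sup>+x. ennreal (?n x) \<partial>lborel) = 1"
    using prob_space.emeasure_space_1[OF prob_space_normal_density[of "sqrt (v/2)" 0]] assms
    by (simp add: emeasure_density)
  have "has_bochner_integral lborel (\<lambda>x. ?n x * x ^ 2) (v / 2)"
  proof -
    have e: "fact (2 * 1) / ((2 / (sqrt (v / 2))\<^sup>2) ^ 1 * fact 1) = v / 2"
      using assms by (simp add: fact_2)
    show ?thesis
      using normal_moment_even[of "sqrt (v/2)" 0 1] assms by (simp only: e diff_zero mult_1_right) simp
  qed
  then have m: "(\<integral>\<^sup>+x. ennreal (?n x * x\<^sup>2) \<partial>lborel) = ennreal (v / 2)"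
    using assms by (subst nn_integral_eq_integral) (auto simp: has_bochner_integral_iff)
  have "(\<integral>\<^sup>+z. ennreal ((norm z)\<^sup>2) \<partial>cn_law v)
    = (\<integral>\<^sup>+z. ennreal (exp (- (norm z)\<^sup>2 / v) / (pi * v)) * ennreal ((norm z)\<^sup>2) \<partial>(lborel :: complex measure))"
    using assms by (simp add: cn_law_def nn_integral_density)
  also have "\<dots> = (\<integral>\<^sup>+z. ennreal (?n (Re z) * (Re z)\<^sup>2) * ennreal (?n (Im z))
      + ennreal (?n (Re z)) * ennreal (?n (Im z) * (Im z)\<^sup>2) \<partial>lborel)"
    unfolding cn_density_eq_prod[OF assms] by (intro nn_integral_cong)
      (simp add: ennreal_mult[symmetric] ennreal_plus[symmetric] cmod_power2 algebra_simps del: ennreal_plus)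
  also have "\<dots> = ennreal (v / 2) + ennreal (v / 2)"
    using nn_integral_lborel_complex_prod[of "\<lambda>x. ennreal (?n x * x\<^sup>2)" "\<lambda>x. ennreal (?n x)"]
      nn_integral_lborel_complex_prod[of "\<lambda>x. ennreal (?n x)" "\<lambda>x. ennreal (?n x * x\<^sup>2)"]
    by (subst nn_integral_add) (auto simp: n m)
  also have "\<dots> = ennreal v"
    using assms by (simp add: ennreal_plus[symmetric] del: ennreal_plus)
  finally show ?thesis .
qed

lemma integral_cn_law_power2:
  assumes "0 < v"
  shows "integrable (cn_law v) (\<lambda>z. (norm z)\<^sup>2)" "(\<integral>z. (norm z)\<^sup>2 \<partial>cn_law v) = v"
  using nn_integral_cn_law_power2[OF assms] assms
    nn_integral_eq_integrable[of "\<lambda>z. (norm z)\<^sup>2" "cn_law v" v] by auto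

lemma distr_uminus_cn_law: "distr (cn_law v) borel uminus = cn_law v"
proof (cases "v = 0")
  case True
  then show ?thesis by (simp add: cn_law_def distr_return)
next
  case False
  have u: "distr lborel borel uminus = (lborel :: complex measure)"
    using lborel_affine[of "-1" "0::complex"] by (simp add: density_1)
  have "distr (cn_law v) borel uminus = distr (cn_law v) lborel uminus"
    by (intro distr_cong) auto
  also have "\<dots> = density (distr lborel lborel uminus) (\<lambda>z. ennreal (exp (- (norm z)\<^sup>2 / v) / (pi * v)))"
    using False by (subst density_distr) (auto simp: cn_law_def)
  also have "distr lborel lborel uminus = distr lborel borel (uminus :: complex \<Rightarrow> _)"
    by (intro distr_cong) auto
  finally show ?thesis using False by (simp add: u cn_law_def)
qed

lemma integral_cn_law_mean: "(\<integral>z. z \<partial>cn_law v) = 0"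
proof -
  have "(\<integral>z. z \<partial>cn_law v) = (\<integral>z. z \<partial>distr (cn_law v) borel uminus)"
    by (simp add: distr_uminus_cn_law)
  also have "\<dots> = - (\<integral>z. z \<partial>cn_law v)"
    by (subst integral_distr) auto
  finally show ?thesis by simp
qed

text \<open>The integrand is the density of \<open>CN(a,s)\<close> with respect to \<open>CN(0,1)\<close>.\<close>

lemma nn_integral_cn_law_backward:
  fixes a :: complex
  assumes "0 < s"
  shows "(\<integral>\<^sup>+x. ennreal (exp ((norm x)\<^sup>2 - (norm (x - a))\<^sup>2 / s) / s) \<partial>cn_law 1) = 1"
proof -
  have "(\<integral>\<^sup>+x. ennreal (exp ((norm x)\<^sup>2 - (norm (x - a))\<^sup>2 / s) / s) \<partial>cn_law 1)
    = (\<integral>\<^sup>+x. ennreal (exp (- (norm (x - a))\<^sup>2 / s) / (pi * s)) \<partial>lborel)"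
    using assms
    by (auto simp: cn_law_def nn_integral_density ennreal_mult[symmetric] mult_exp_exp mult.commute
      intro!: nn_integral_cong arg_cong[where f = ennreal])
  then show ?thesis using nn_integral_cn_density[OF assms, of a] by simp
qed

section \<open>Second moments and independence\<close>

lemma borel_measurable_cnj [measurable (raw)]:
  "f \<in> borel_measurable M \<Longrightarrow> (\<lambda>x. cnj (f x)) \<in> borel_measurable M"
  by (rule measurable_compose[OF _ borel_measurable_continuous_onI[OF continuous_on_cnj[OF continuous_on_id]]])

lemma borel_measurable_fst_borel:
  "f \<in> borel_measurable M \<Longrightarrow> (\<lambda>x. fst (f x)) \<in> borel_measurable M"
  by (rule measurable_compose[OF _ borel_measurable_continuous_onI[OF continuous_on_fst[OF continuous_on_id]]])

lemma borel_measurable_snd_borel: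
  "f \<in> borel_measurable M \<Longrightarrow> (\<lambda>x. snd (f x)) \<in> borel_measurable M"
  by (rule measurable_compose[OF _ borel_measurable_continuous_onI[OF continuous_on_snd[OF continuous_on_id]]])

lemma borel_measurable_vec_nth_borel:
  "f \<in> borel_measurable M \<Longrightarrow> (\<lambda>x. f x $ i) \<in> borel_measurable M"
  by (rule measurable_compose[OF _ borel_measurable_continuous_onI[OF continuous_on_component[OF continuous_on_id]]])

lemma borel_measurable_cinner:
  assumes "f \<in> borel_measurable M" "g \<in> borel_measurable M"
  shows "(\<lambda>x. cinner (f x) (g x)) \<in> borel_measurable M"
proof -
  have [measurable]: "(\<lambda>x. f x $ i) \<in> borel_measurable M" "(\<lambda>x. g x $ i) \<in> borel_measurable M" for i
    using assms by (auto intro: borel_measurable_vec_nth_borel)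
  show ?thesis unfolding cinner_def by measurable
qed

lemma (in prob_space) integrable_of_norm2:
  fixes f :: "'a \<Rightarrow> complex"
  assumes [measurable]: "f \<in> borel_measurable M" and i: "integrable M (\<lambda>x. (norm (f x))\<^sup>2)"
  shows "integrable M f"
proof (rule integrable_norm_cancel)
  show "integrable M (\<lambda>x. norm (f x))"
    by (rule square_integrable_imp_integrable[OF _ i]) measurable
qed measurable

lemma integrable_mult_cnj:
  fixes f g :: "'a \<Rightarrow> complex"
  assumes [measurable]: "f \<in> borel_measurable M" "g \<in> borel_measurable M"
    and "integrable M (\<lambda>x. (norm (f x))\<^sup>2)" "integrable M (\<lambda>x. (norm (g x))\<^sup>2)"
  shows "integrable M (\<lambda>x. f x * cnj (g x))"
proof (rule Bochner_Integration.integrable_bound)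
  show "integrable M (\<lambda>x. (norm (f x))\<^sup>2 + (norm (g x))\<^sup>2)" using assms by simp
  have "norm (f x) * norm (g x) \<le> (norm (f x))\<^sup>2 + (norm (g x))\<^sup>2" for x
    using sum_squares_bound[of "norm (f x)" "norm (g x)"]
      mult_nonneg_nonneg[OF norm_ge_zero[of "f x"] norm_ge_zero[of "g x"]] by linarith
  then show "AE x in M. norm (f x * cnj (g x)) \<le> norm ((norm (f x))\<^sup>2 + (norm (g x))\<^sup>2)"
    by (simp add: norm_mult)
qed simp

lemma (in prob_space) integral_norm_sum_orthogonal:
  fixes b u :: "'j \<Rightarrow> 'a \<Rightarrow> complex"
  assumes J: "finite J"
    and [measurable]: "\<And>j. j \<in> J \<Longrightarrow> b j \<in> borel_measurable M" "\<And>j. j \<in> J \<Longrightarrow> u j \<in> borel_measurable M"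
    and b2: "\<And>j. j \<in> J \<Longrightarrow> integrable M (\<lambda>x. (norm (b j x))\<^sup>2)"
    and u2: "\<And>j. j \<in> J \<Longrightarrow> integrable M (\<lambda>x. (norm (u j x))\<^sup>2)"
    and ind: "\<And>i j. i \<in> J \<Longrightarrow> j \<in> J \<Longrightarrow>
      indep_var borel (\<lambda>x. b i x * cnj (b j x)) borel (\<lambda>x. u i x * cnj (u j x))"
    and orth: "\<And>i j. i \<in> J \<Longrightarrow> j \<in> J \<Longrightarrow> i \<noteq> j \<Longrightarrow> (\<integral>x. u i x * cnj (u j x) \<partial>M) = 0"
  shows "integrable M (\<lambda>x. (norm (\<Sum>j\<in>J. b j x * u j x))\<^sup>2)"
    and "(\<integral>x. (norm (\<Sum>j\<in>J. b j x * u j x))\<^sup>2 \<partial>M)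
      = (\<Sum>j\<in>J. (\<integral>x. (norm (b j x))\<^sup>2 \<partial>M) * (\<integral>x. (norm (u j x))\<^sup>2 \<partial>M))"
proof -
  let ?t = "\<lambda>i j x. (b i x * cnj (b j x)) * (u i x * cnj (u j x))"
  have ex: "complex_of_real ((norm (\<Sum>j\<in>J. b j x * u j x))\<^sup>2) = (\<Sum>i\<in>J. \<Sum>j\<in>J. ?t i j x)" for x
    by (simp only: complex_norm_square sum_distrib_left sum_distrib_right cnj_sum complex_cnj_mult)
      (subst sum.swap, simp add: mult_ac)
  have bi: "integrable M (\<lambda>x. b i x * cnj (b j x))" and ui: "integrable M (\<lambda>x. u i x * cnj (u j x))"
    if "i \<in> J" "j \<in> J" for i j
    using that by (auto intro!: integrable_mult_cnj b2 u2)
  have ti: "integrable M (?t i j)" if "i \<in> J" "j \<in> J" for i j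
    using that by (intro indep_var_integrable ind bi ui)
  have te: "(\<integral>x. ?t i j x \<partial>M) = (\<integral>x. b i x * cnj (b j x) \<partial>M) * (\<integral>x. u i x * cnj (u j x) \<partial>M)"
    if "i \<in> J" "j \<in> J" for i j
    using that by (intro indep_var_lebesgue_integral ind bi ui)
  have "integrable M (\<lambda>x. \<Sum>i\<in>J. \<Sum>j\<in>J. ?t i j x)"
    by (intro Bochner_Integration.integrable_sum ti)
  then have ci: "integrable M (\<lambda>x. complex_of_real ((norm (\<Sum>j\<in>J. b j x * u j x))\<^sup>2))"
    by (simp only: ex)
  then show "integrable M (\<lambda>x. (norm (\<Sum>j\<in>J. b j x * u j x))\<^sup>2)"
    using integrable_Re[OF ci] by (simp only: Re_complex_of_real)
  have "complex_of_real (\<integral>x. (norm (\<Sum>j\<in>J. b j x * u j x))\<^sup>2 \<partial>M)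
      = (\<integral>x. (\<Sum>i\<in>J. \<Sum>j\<in>J. ?t i j x) \<partial>M)"
    by (simp only: ex integral_complex_of_real[symmetric])
  also have "\<dots> = (\<Sum>i\<in>J. \<Sum>j\<in>J. (\<integral>x. ?t i j x \<partial>M))"
    by (subst Bochner_Integration.integral_sum, intro Bochner_Integration.integrable_sum ti, assumption+)
      (intro sum.cong refl Bochner_Integration.integral_sum ti, assumption+)
  also have "\<dots> = (\<Sum>i\<in>J. \<Sum>j\<in>J. if j = i then
      (\<integral>x. b i x * cnj (b i x) \<partial>M) * (\<integral>x. u i x * cnj (u i x) \<partial>M) else 0)"
    by (intro sum.cong refl) (auto simp: te orth)
  also have "\<dots> = (\<Sum>i\<in>J. (\<integral>x. b i x * cnj (b i x) \<partial>M) * (\<integral>x. u i x * cnj (u i x) \<partial>M))"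
    using J by simp
  also have "\<dots> = complex_of_real (\<Sum>j\<in>J. (\<integral>x. (norm (b j x))\<^sup>2 \<partial>M) * (\<integral>x. (norm (u j x))\<^sup>2 \<partial>M))"
    by (simp only: complex_norm_square[symmetric] integral_complex_of_real of_real_sum of_real_mult)
  finally show "(\<integral>x. (norm (\<Sum>j\<in>J. b j x * u j x))\<^sup>2 \<partial>M)
      = (\<Sum>j\<in>J. (\<integral>x. (norm (b j x))\<^sup>2 \<partial>M) * (\<integral>x. (norm (u j x))\<^sup>2 \<partial>M))"
    by (simp only: of_real_eq_iff)
qed

lemma (in prob_space) indep_sets_reindex:
  assumes "indep_sets F (f ` I)" "inj_on f I"
  shows "indep_sets (\<lambda>i. F (f i)) I"
  unfolding indep_sets_def
proof (intro conjI ballI allI impI)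
  fix i assume "i \<in> I"
  then show "F (f i) \<subseteq> events" using assms(1) by (auto simp: indep_sets_def)
next
  fix J A assume J: "J \<subseteq> I" "J \<noteq> {}" "finite J" and A: "A \<in> (\<Pi> i\<in>J. F (f i))"
  have inj: "inj_on f J" using assms(2) J(1) inj_on_subset by blast
  define B where "B = A \<circ> the_inv_into J f"
  have B: "B (f i) = A i" if "i \<in> J" for i
    using that inj by (simp add: B_def the_inv_into_f_f)
  have "prob (\<Inter>i\<in>f ` J. B i) = (\<Prod>i\<in>f ` J. prob (B i))"
    using J A B by (intro indep_setsD[OF assms(1)]) auto
  then show "prob (\<Inter>j\<in>J. A j) = (\<Prod>j\<in>J. prob (A j))"
    using inj B by (simp add: prod.reindex)
qed

lemma indep_vars_pair_measure:
  fixes X :: "'i \<Rightarrow> 'a \<Rightarrow> 'c" and Y :: "'i \<Rightarrow> 'b \<Rightarrow> 'c"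
  assumes M1: "prob_space M1" and M2: "prob_space M2"
    and X: "prob_space.indep_vars M1 N X I" and Y: "prob_space.indep_vars M2 N Y J"
    and fin: "finite I" "finite J" and ne: "I \<noteq> {}" "J \<noteq> {}" and IJ: "I \<inter> J = {}"
  shows "prob_space.indep_vars (M1 \<Otimes>\<^sub>M M2) N (\<lambda>i p. if i \<in> I then X i (fst p) else Y i (snd p)) (I \<union> J)"
    and "i \<in> I \<Longrightarrow> distr (M1 \<Otimes>\<^sub>M M2) (N i) (\<lambda>p. X i (fst p)) = distr M1 (N i) (X i)"
    and "j \<in> J \<Longrightarrow> distr (M1 \<Otimes>\<^sub>M M2) (N j) (\<lambda>p. Y j (snd p)) = distr M2 (N j) (Y j)"
proof -
  interpret M1: prob_space M1 by fact
  interpret M2: prob_space M2 by fact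
  interpret P: pair_prob_space M1 M2 ..
  have Xm[measurable]: "\<And>i. i \<in> I \<Longrightarrow> X i \<in> measurable M1 (N i)"
    using X by (simp add: M1.indep_vars_def)
  have Ym[measurable]: "\<And>i. i \<in> J \<Longrightarrow> Y i \<in> measurable M2 (N i)"
    using Y by (simp add: M2.indep_vars_def)
  let ?Z = "\<lambda>i p. if i \<in> I then X i (fst p) else Y i (snd p)"
  have dX: "distr (M1 \<Otimes>\<^sub>M M2) (N i) (\<lambda>p. X i (fst p)) = distr M1 (N i) (X i)" if "i \<in> I" for i
  proof -
    have "distr (M1 \<Otimes>\<^sub>M M2) (N i) (X i \<circ> fst) = distr (distr (M1 \<Otimes>\<^sub>M M2) M1 fst) (N i) (X i)"
      using that by (subst distr_distr) auto
    then show ?thesis by (simp add: M2.distr_pair_fst o_def)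
  qed
  have snd: "distr (M1 \<Otimes>\<^sub>M M2) M2 snd = M2"
  proof -
    have "M1 \<Otimes>\<^sub>M M2 = distr (M2 \<Otimes>\<^sub>M M1) (M1 \<Otimes>\<^sub>M M2) (\<lambda>(x, y). (y, x))"
      by (rule P.distr_pair_swap)
    then have "distr (M1 \<Otimes>\<^sub>M M2) M2 snd = distr (distr (M2 \<Otimes>\<^sub>M M1) (M1 \<Otimes>\<^sub>M M2) (\<lambda>(x, y). (y, x))) M2 snd"
      by simp
    also have "\<dots> = distr (M2 \<Otimes>\<^sub>M M1) M2 fst"
      by (subst distr_distr) (auto simp: o_def split_beta)
    finally show ?thesis by (simp add: M1.distr_pair_fst)
  qed
  have dY: "distr (M1 \<Otimes>\<^sub>M M2) (N i) (\<lambda>p. Y i (snd p)) = distr M2 (N i) (Y i)" if "i \<in> J" for i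
  proof -
    have "distr (M1 \<Otimes>\<^sub>M M2) (N i) (Y i \<circ> snd) = distr (distr (M1 \<Otimes>\<^sub>M M2) M2 snd) (N i) (Y i)"
      using that by (subst distr_distr) auto
    then show ?thesis by (simp add: snd o_def)
  qed
  show "i \<in> I \<Longrightarrow> distr (M1 \<Otimes>\<^sub>M M2) (N i) (\<lambda>p. X i (fst p)) = distr M1 (N i) (X i)"
    and "j \<in> J \<Longrightarrow> distr (M1 \<Otimes>\<^sub>M M2) (N j) (\<lambda>p. Y j (snd p)) = distr M2 (N j) (Y j)"
    by (rule dX dY, assumption)+
  have Zm[measurable]: "\<And>i. i \<in> I \<union> J \<Longrightarrow> ?Z i \<in> measurable (M1 \<Otimes>\<^sub>M M2) (N i)"
  proof -
    fix i assume "i \<in> I \<union> J"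
    then show "?Z i \<in> measurable (M1 \<Otimes>\<^sub>M M2) (N i)"
      by (cases "i \<in> I") auto
  qed
  define L where "L i = (if i \<in> I \<union> J then distr (M1 \<Otimes>\<^sub>M M2) (N i) (?Z i) else return (count_space UNIV) undefined)" for i
  have pL: "prob_space (L i)" for i
    by (auto simp: L_def intro!: P.prob_space_distr Zm prob_space_return)
  interpret L: product_prob_space L by (rule product_prob_spaceI) (rule pL)
  have LX: "PiM I (\<lambda>i. distr M1 (N i) (X i)) = PiM I L"
    by (intro PiM_cong) (auto simp: L_def dX)
  have LY: "PiM J (\<lambda>i. distr M2 (N i) (Y i)) = PiM J L"
    using IJ by (intro PiM_cong) (auto simp: L_def dY[symmetric] intro!: distr_cong)
  have DX: "distr M1 (PiM I N) (\<lambda>x. \<lambda>i\<in>I. X i x) = PiM I L"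
    using X M1.indep_vars_iff_distr_eq_PiM'[of I X N] ne by (simp add: LX)
  have DY: "distr M2 (PiM J N) (\<lambda>x. \<lambda>i\<in>J. Y i x) = PiM J L"
    using Y M2.indep_vars_iff_distr_eq_PiM'[of J Y N] ne by (simp add: LY)
  have sL: "sets (PiM (I \<union> J) L) = sets (PiM (I \<union> J) N)"
    by (intro sets_PiM_cong) (auto simp: L_def)
  have "PiM (I \<union> J) L = distr (PiM I L \<Otimes>\<^sub>M PiM J L) (PiM (I \<union> J) L) (merge I J)"
    by (rule L.distr_merge[symmetric]) fact+
  also have "\<dots> = distr (PiM I L \<Otimes>\<^sub>M PiM J L) (PiM (I \<union> J) N) (merge I J)"
    by (intro distr_cong sL refl)
  also have "PiM I L \<Otimes>\<^sub>M PiM J L = distr (M1 \<Otimes>\<^sub>M M2) (PiM I N \<Otimes>\<^sub>M PiM J N)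
      (\<lambda>(x, y). (\<lambda>i\<in>I. X i x, \<lambda>i\<in>J. Y i y))"
    unfolding DX[symmetric] DY[symmetric]
    by (intro pair_measure_distr prob_space_imp_sigma_finite M2.prob_space_distr) auto
  also have "distr \<dots> (PiM (I \<union> J) N) (merge I J) = distr (M1 \<Otimes>\<^sub>M M2) (PiM (I \<union> J) N)
      (\<lambda>p. \<lambda>i\<in>I \<union> J. ?Z i p)"
    by (subst distr_distr[OF measurable_merge]) (auto simp: merge_def o_def split_beta intro!: distr_cong)
  finally have "distr (M1 \<Otimes>\<^sub>M M2) (PiM (I \<union> J) N) (\<lambda>p. \<lambda>i\<in>I \<union> J. ?Z i p) = PiM (I \<union> J) L" ..
  also have "\<dots> = PiM (I \<union> J) (\<lambda>i. distr (M1 \<Otimes>\<^sub>M M2) (N i) (?Z i))"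
    by (intro PiM_cong) (auto simp: L_def)
  finally show "P.indep_vars N ?Z (I \<union> J)"
    using ne Zm by (subst P.indep_vars_iff_distr_eq_PiM') auto
qed

lemma indep_vars_PiM_reindex:
  assumes M: "\<And>i. i \<in> K \<Longrightarrow> prob_space (M i)" and f: "inj_on f I" "f ` I \<subseteq> K" and ne: "I \<noteq> {}"
  shows "prob_space.indep_vars (PiM K M) (\<lambda>i. M (f i)) (\<lambda>i x. x (f i)) I"
    and "i \<in> K \<Longrightarrow> distr (PiM K M) (M i) (\<lambda>x. x i) = M i"
proof -
  interpret P: prob_space "PiM K M" by (rule prob_space_PiM) fact
  show d: "i \<in> K \<Longrightarrow> distr (PiM K M) (M i) (\<lambda>x. x i) = M i" for i
    using M by (rule distr_PiM_component)
  have "distr (PiM K M) (PiM I (\<lambda>i. M (f i))) (\<lambda>x. \<lambda>i\<in>I. x (f i)) = PiM I (\<lambda>i. M (f i))"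
    using f by (intro distr_PiM_reindex M) auto
  also have "\<dots> = PiM I (\<lambda>i. distr (PiM K M) (M (f i)) (\<lambda>x. x (f i)))"
    using f by (intro PiM_cong) (auto simp: d)
  finally show "P.indep_vars (\<lambda>i. M (f i)) (\<lambda>i x. x (f i)) I"
    using f ne by (subst P.indep_vars_iff_distr_eq_PiM') auto
qed

lemma (in prob_space) integral_norm2_deviation:
  fixes X :: "'a \<Rightarrow> complex"
  assumes "integrable M X" "integrable M (\<lambda>x. (norm (X x))\<^sup>2)"
  shows "(\<integral>x. (norm (X x))\<^sup>2 \<partial>M) = cvar M X + (norm (\<integral>x. X x \<partial>M))\<^sup>2"
proof -
  let ?m = "\<integral>x. X x \<partial>M"
  have e: "(norm (X x - ?m))\<^sup>2 = (norm (X x))\<^sup>2 - 2 * Re (cnj ?m * X x) + (norm ?m)\<^sup>2" for x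
    unfolding cmod_power2 by (simp add: power2_eq_square algebra_simps)
  have i: "integrable M (\<lambda>x. Re (cnj ?m * X x))" using assms by (intro integrable_Re integrable_mult_right)
  have "(\<integral>x. Re (cnj ?m * X x) \<partial>M) = Re (cnj ?m * ?m)"
    using assms by (subst integral_Re) auto
  also have "\<dots> = (norm ?m)\<^sup>2" by (simp add: cmod_power2) (simp add: power2_eq_square)
  finally have "(\<integral>x. Re (cnj ?m * X x) \<partial>M) = (norm ?m)\<^sup>2" .
  then have "cvar M X = (\<integral>x. (norm (X x))\<^sup>2 \<partial>M) - 2 * (norm ?m)\<^sup>2 + (norm ?m)\<^sup>2"
    unfolding cvar_def e using assms i by (simp add: prob_space)
  then show ?thesis by simp
qed

lemma (in prob_space) indep_vars_imp_indep_var_restrict: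
  fixes W :: "'i \<Rightarrow> 'a \<Rightarrow> 'b::topological_space" and f g :: "('i \<Rightarrow> 'b) \<Rightarrow> 'c"
  assumes W: "indep_vars (\<lambda>_. borel) W I" and AB: "A \<subseteq> I" "B \<subseteq> I" "A \<inter> B = {}"
    and f: "f \<in> measurable (PiM A (\<lambda>_. borel)) N" and g: "g \<in> measurable (PiM B (\<lambda>_. borel)) L"
  shows "indep_var N (\<lambda>x. f (\<lambda>i\<in>A. W i x)) L (\<lambda>x. g (\<lambda>i\<in>B. W i x))"
  using indep_var_compose[OF indep_var_restrict[OF W AB(3,1,2)] f g] by (simp add: o_def)

lemma distr_Pair_moments:
  fixes f :: "'p \<Rightarrow> 'b::second_countable_topology \<times> complex"
  assumes f: "f \<in> borel_measurable P" and law: "distr P borel f = distr \<nu> borel (Pair a)"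
    and \<nu>: "sets \<nu> = sets borel" and g: "g \<in> borel_measurable (borel :: complex measure)"
  shows "(\<integral>p. g (snd (f p)) \<partial>P) = (\<integral>z. g z \<partial>\<nu>)"
    and "integrable P (\<lambda>p. g (snd (f p))) \<longleftrightarrow> integrable \<nu> (g :: complex \<Rightarrow> 'd::{banach, second_countable_topology})"
proof -
  have m: "Pair a \<in> borel_measurable \<nu>"
    unfolding measurable_cong_sets[OF \<nu> refl] by (intro borel_measurable_Pair) auto
  have g': "(\<lambda>v. g (snd v)) \<in> borel_measurable (borel :: ('b \<times> complex) measure)"
    by (intro measurable_compose[OF borel_measurable_snd_borel g]) simp
  show "(\<integral>p. g (snd (f p)) \<partial>P) = (\<integral>z. g z \<partial>\<nu>)"
    using integral_distr[OF f g'] integral_distr[OF m g'] law by simp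
  show "integrable P (\<lambda>p. g (snd (f p))) \<longleftrightarrow> integrable \<nu> g"
    using integrable_distr_eq[OF f g'] integrable_distr_eq[OF m g'] law by simp
qed

lemma norm2_one_minus: "(norm (1 - c * z))\<^sup>2 = 1 - 2 * Re (c * z) + (norm c)\<^sup>2 * (norm z)\<^sup>2" for c z :: complex
proof -
  have "(norm (1 - c * z))\<^sup>2 = 1 - 2 * Re (c * z) + (norm (c * z))\<^sup>2"
    unfolding cmod_power2 by (simp add: power2_eq_square algebra_simps)
  then show ?thesis by (simp add: norm_mult power_mult_distrib)
qed

section \<open>Lower bounds on mutual information\<close>

lemma KL_divergence_ge:
  fixes f :: "'a \<Rightarrow> real"
  assumes Q: "prob_space Q" and J: "prob_space J" and sets: "sets J = sets Q"
    and ac: "absolutely_continuous Q J" and int: "integrable J (entropy_density 2 Q J)"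
    and f[measurable]: "f \<in> borel_measurable Q" and pos: "\<And>x. 0 < f x"
    and le1: "(\<integral>\<^sup>+x. ennreal (f x) \<partial>Q) \<le> 1" and intf: "integrable J (\<lambda>x. ln (f x))"
  shows "(\<integral>x. ln (f x) \<partial>J) / ln 2 \<le> KL_divergence 2 Q J"
proof -
  interpret Q: prob_space Q by fact
  interpret J: prob_space J by fact
  let ?R = "RN_deriv Q J" let ?r = "\<lambda>x. enn2real (?R x)"
  have JD: "J = density Q ?R" using ac sets by (simp add: Q.density_RN_deriv)
  have [measurable]: "?R \<in> borel_measurable J" "f \<in> borel_measurable J"
    by (simp_all add: measurable_cong_sets[OF sets refl] f)
  have "(\<integral>\<^sup>+x. ennreal (f x / ?r x) \<partial>J) = (\<integral>\<^sup>+x. ?R x * ennreal (f x / ?r x) \<partial>Q)"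
    by (subst JD, subst nn_integral_density) auto
  also have "\<dots> \<le> (\<integral>\<^sup>+x. ennreal (f x) \<partial>Q)"
  proof (intro nn_integral_mono)
    fix x
    show "?R x * ennreal (f x / ?r x) \<le> ennreal (f x)"
      using pos[of x] by (cases "?R x") (auto simp: ennreal_mult[symmetric])
  qed
  also note le1
  finally have u1: "(\<integral>\<^sup>+x. ennreal (f x / ?r x) \<partial>J) \<le> 1" .
  have ui: "integrable J (\<lambda>x. f x / ?r x)"
    using u1 by (intro integrableI_nonneg) (auto simp: le_less_trans less_imp_le[OF pos])
  have "ennreal (\<integral>x. f x / ?r x \<partial>J) \<le> 1"
    using u1 pos by (subst nn_integral_eq_integral[OF ui, symmetric]) (auto simp: less_imp_le)
  then have u2: "(\<integral>x. f x / ?r x \<partial>J) \<le> 1" by (simp add: ennreal_le_1)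
  have ae: "AE x in J. 0 < ?r x"
  proof -
    have "AE x in Q. ?R x \<noteq> \<infinity>"
      using ac sets J.sigma_finite_measure_axioms by (intro Q.RN_deriv_finite) auto
    then have "AE x in density Q ?R. ?R x \<noteq> 0 \<and> ?R x \<noteq> \<infinity>"
      by (subst AE_density) auto
    then show ?thesis unfolding JD[symmetric] by (auto simp: enn2real_positive_iff less_top zero_less_iff_neq_zero elim!: eventually_mono)
  qed
  have E: "entropy_density 2 Q J = (\<lambda>x. ln (?r x) / ln 2)"
    by (auto simp: entropy_density_def log_def)
  have lr: "integrable J (\<lambda>x. ln (?r x))"
    using integrable_mult_right[OF int, of "ln 2"] by (simp add: E)
  have "(\<integral>x. ln (f x) \<partial>J) - (\<integral>x. ln (?r x) \<partial>J) = (\<integral>x. ln (f x) - ln (?r x) \<partial>J)"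
    using intf lr by simp
  also have "\<dots> \<le> (\<integral>x. f x / ?r x - 1 \<partial>J)"
  proof (intro integral_mono_AE)
    show "AE x in J. ln (f x) - ln (?r x) \<le> f x / ?r x - 1"
      using ae
    proof eventually_elim
      case (elim x)
      then show ?case using pos[of x] ln_le_minus_one[of "f x / ?r x"] by (simp add: ln_div)
    qed
  qed (use intf lr ui in auto)
  also have "\<dots> \<le> 0" using ui u2 by (simp add: J.prob_space)
  finally have "(\<integral>x. ln (f x) \<partial>J) \<le> (\<integral>x. ln (?r x) \<partial>J)" by simp
  then show ?thesis by (simp add: KL_divergence_def E divide_right_mono)
qed

lemma mutual_info_ge:
  fixes f :: "'a \<times> 'b \<Rightarrow> real"
  assumes P: "prob_space P" and X[measurable]: "X \<in> measurable P A" and Y[measurable]: "Y \<in> measurable P B"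
    and f[measurable]: "f \<in> borel_measurable (A \<Otimes>\<^sub>M B)" and pos: "\<And>x. 0 < f x"
    and le1: "\<And>y. y \<in> space B \<Longrightarrow> (\<integral>\<^sup>+x. ennreal (f (x, y)) \<partial>distr P A X) \<le> 1"
    and intf: "integrable P (\<lambda>\<omega>. ln (f (X \<omega>, Y \<omega>)))"
  shows "ereal ((\<integral>\<omega>. ln (f (X \<omega>, Y \<omega>)) \<partial>P) / ln 2) \<le> mutual_info P A B X Y"
proof -
  interpret P: prob_space P by fact
  let ?Q = "distr P A X \<Otimes>\<^sub>M distr P B Y" and ?J = "distr P (A \<Otimes>\<^sub>M B) (\<lambda>\<omega>. (X \<omega>, Y \<omega>))"
  interpret PX: prob_space "distr P A X" by (rule P.prob_space_distr) simp
  interpret PY: prob_space "distr P B Y" by (rule P.prob_space_distr) simp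
  interpret PXY: pair_prob_space "distr P A X" "distr P B Y" ..
  have f': "f \<in> borel_measurable ?Q" by measurable
  have "(\<integral>\<^sup>+x. ennreal (f x) \<partial>?Q) = (\<integral>\<^sup>+y. \<integral>\<^sup>+x. ennreal (f (x, y)) \<partial>distr P A X \<partial>distr P B Y)"
    using f' by (subst PXY.nn_integral_snd[symmetric]) auto
  also have "\<dots> \<le> (\<integral>\<^sup>+y. 1 \<partial>distr P B Y)"
    using le1 by (intro nn_integral_mono) auto
  also have "\<dots> = 1" by (simp add: PY.emeasure_space_1[simplified])
  finally have le: "(\<integral>\<^sup>+x. ennreal (f x) \<partial>?Q) \<le> 1" .
  have i: "integrable ?J (\<lambda>x. ln (f x))" using intf by (subst integrable_distr_eq) auto
  have e: "(\<integral>x. ln (f x) \<partial>?J) = (\<integral>\<omega>. ln (f (X \<omega>, Y \<omega>)) \<partial>P)" by (subst integral_distr) auto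
  have J: "prob_space ?J" by (rule P.prob_space_distr) simp
  have s: "sets ?J = sets ?Q" by simp
  show ?thesis
  proof (cases "absolutely_continuous ?Q ?J \<and> integrable ?J (entropy_density 2 ?Q ?J)")
    case True
    then have "(\<integral>x. ln (f x) \<partial>?J) / ln 2 \<le> KL_divergence 2 ?Q ?J"
      by (intro KL_divergence_ge[OF PXY.prob_space_axioms J s _ _ f' pos le i]) auto
    then show ?thesis using True by (simp add: mutual_info_def Let_def e)
  next
    case False
    then show ?thesis by (auto simp add: mutual_info_def Let_def)
  qed
qed

lemma mutual_info_cn_input_ge:
  fixes z :: "'i \<Rightarrow> 'b \<Rightarrow> complex"
  assumes I: "finite I" and M: "prob_space M" and s: "0 < s"
    and Y[measurable]: "Y \<in> measurable (PiM I (\<lambda>_. cn_law 1) \<Otimes>\<^sub>M M) B"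
    and z[measurable]: "\<And>i. i \<in> I \<Longrightarrow> z i \<in> borel_measurable B"
    and int: "\<And>i. i \<in> I \<Longrightarrow> integrable (PiM I (\<lambda>_. cn_law 1) \<Otimes>\<^sub>M M) (\<lambda>p. (norm (fst p i - z i (Y p)))\<^sup>2)"
    and mse: "\<And>i. i \<in> I \<Longrightarrow> (\<integral>p. (norm (fst p i - z i (Y p)))\<^sup>2 \<partial>(PiM I (\<lambda>_. cn_law 1) \<Otimes>\<^sub>M M)) = s"
  shows "ereal (real (card I) * log 2 (1 / s))
    \<le> mutual_info (PiM I (\<lambda>_. cn_law 1) \<Otimes>\<^sub>M M) (PiM I (\<lambda>_. borel)) B fst Y"
proof -
  let ?X = "PiM I (\<lambda>_. cn_law 1)" let ?P = "?X \<Otimes>\<^sub>M M"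
  interpret X: prob_space ?X by (intro prob_space_PiM prob_space_cn_law) simp
  interpret M: prob_space M by fact
  interpret P: pair_prob_space ?X M ..
  have sX[measurable_cong]: "sets ?X = sets (PiM I (\<lambda>_. borel))" by (intro sets_PiM_cong) auto
  define g :: "'i \<Rightarrow> ('i \<Rightarrow> complex) \<times> 'b \<Rightarrow> real" where
    "g i = (\<lambda>(x, y). exp ((norm (x i))\<^sup>2 - (norm (x i - z i y))\<^sup>2 / s) / s)" for i
  define f where "f p = (\<Prod>i\<in>I. g i p)" for p
  have gpos: "0 < g i p" for i p using s by (auto simp: g_def split: prod.split)
  have [measurable]: "g i \<in> borel_measurable (PiM I (\<lambda>_. borel) \<Otimes>\<^sub>M B)" if "i \<in> I" for i
    using that unfolding g_def by measurable
  have fm: "f \<in> borel_measurable (PiM I (\<lambda>_. borel) \<Otimes>\<^sub>M B)" unfolding f_def by measurable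
  have mX: "distr ?P (PiM I (\<lambda>_. borel)) fst = ?X"
  proof -
    have "distr ?P (PiM I (\<lambda>_. borel)) fst = distr ?P ?X fst"
      by (intro distr_cong) (auto simp: sX)
    then show ?thesis by (simp add: M.distr_pair_fst)
  qed
  have one: "(\<integral>\<^sup>+x. ennreal (f (x, y)) \<partial>?X) = 1" for y
  proof -
    interpret L: product_prob_space "\<lambda>i::'i. cn_law 1" by (intro product_prob_spaceI prob_space_cn_law) simp
    have "(\<integral>\<^sup>+x. ennreal (f (x, y)) \<partial>?X)
      = (\<integral>\<^sup>+x. (\<Prod>i\<in>I. ennreal (exp ((norm (x i))\<^sup>2 - (norm (x i - z i y))\<^sup>2 / s) / s)) \<partial>?X)"
      using gpos s by (auto simp: f_def g_def prod_ennreal intro!: nn_integral_cong)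
    also have "\<dots> = (\<Prod>i\<in>I. \<integral>\<^sup>+x. ennreal (exp ((norm x)\<^sup>2 - (norm (x - z i y))\<^sup>2 / s) / s) \<partial>cn_law 1)"
      using I by (intro L.product_nn_integral_prod) auto
    finally show ?thesis using s by (simp add: nn_integral_cn_law_backward)
  qed
  have lnf: "ln (f p) = (\<Sum>i\<in>I. (norm (fst p i))\<^sup>2 - (norm (fst p i - z i (snd p)))\<^sup>2 / s - ln s)" for p
  proof -
    have "ln (f p) = (\<Sum>i\<in>I. ln (g i p))"
      unfolding f_def using I by (intro ln_prod) (simp_all add: order_less_imp_not_eq2[OF gpos])
    also have "\<dots> = (\<Sum>i\<in>I. (norm (fst p i))\<^sup>2 - (norm (fst p i - z i (snd p)))\<^sup>2 / s - ln s)"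
      using s by (intro sum.cong) (auto simp: g_def ln_div split: prod.split)
    finally show ?thesis .
  qed
  have x2: "integrable ?P (\<lambda>p. (norm (fst p i))\<^sup>2)" "(\<integral>p. (norm (fst p i))\<^sup>2 \<partial>?P) = 1" if i: "i \<in> I" for i
  proof -
    have d: "distr ?X (cn_law 1) (\<lambda>x. x i) = cn_law 1"
      using i by (intro distr_PiM_component prob_space_cn_law) auto
    have "distr ?P (cn_law 1) ((\<lambda>x. x i) \<circ> fst) = distr (distr ?P ?X fst) (cn_law 1) (\<lambda>x. x i)"
      using i by (subst distr_distr) auto
    then have d': "distr ?P (cn_law 1) (\<lambda>p. fst p i) = cn_law 1"
      by (simp add: M.distr_pair_fst d o_def)
    have m: "(\<lambda>p. fst p i) \<in> measurable ?P (cn_law 1)" using i by auto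
    show "integrable ?P (\<lambda>p. (norm (fst p i))\<^sup>2)"
      using integrable_distr[OF m, of "\<lambda>z. (norm z)\<^sup>2"] integral_cn_law_power2(1)[of 1] by (simp add: d')
    show "(\<integral>p. (norm (fst p i))\<^sup>2 \<partial>?P) = 1"
      using integral_distr[OF m, of "\<lambda>z. (norm z)\<^sup>2"] integral_cn_law_power2(2)[of 1] by (simp add: d')
  qed
  have i1: "integrable ?P (\<lambda>p. (norm (fst p i))\<^sup>2 - (norm (fst p i - z i (Y p)))\<^sup>2 / s - ln s)" if "i \<in> I" for i
    using that x2 int by (intro Bochner_Integration.integrable_diff) auto
  have i2: "(\<integral>p. (norm (fst p i))\<^sup>2 - (norm (fst p i - z i (Y p)))\<^sup>2 / s - ln s \<partial>?P) = ln (1 / s)" if "i \<in> I" for i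
    using has_bochner_integral_diff[OF has_bochner_integral_diff[OF
        has_bochner_integral_integrable[OF x2(1)[OF that]]
        has_bochner_integral_divide[OF has_bochner_integral_integrable[OF int[OF that]], of s]]
        has_bochner_integral_integrable[OF P.integrable_const[of "ln s"]]]
      that s by (simp add: has_bochner_integral_iff x2 mse P.prob_space ln_div)
  have "ereal ((\<integral>p. ln (f (fst p, Y p)) \<partial>?P) / ln 2) \<le> mutual_info ?P (PiM I (\<lambda>_. borel)) B fst Y"
  proof (rule mutual_info_ge)
    show "integrable ?P (\<lambda>p. ln (f (fst p, Y p)))"
      unfolding lnf fst_conv snd_conv by (intro Bochner_Integration.integrable_sum i1)
    show "0 < f p" for p unfolding f_def by (intro prod_pos ballI gpos)
  qed (auto simp: mX one fm P.prob_space_axioms)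
  also have "(\<integral>p. ln (f (fst p, Y p)) \<partial>?P) = real (card I) * ln (1 / s)"
    unfolding lnf fst_conv snd_conv by (subst Bochner_Integration.integral_sum) (auto simp: i1 i2)
  finally show ?thesis by (simp add: log_def)
qed

section \<open>One coherence interval as a family of independent sources\<close>

type_synonym ('c, 'u, 'm) csi = "(complex ^ 'm ^ 'u ^ 'c ^ 'c) \<times> (complex ^ 'm ^ 'u ^ 'c ^ 'c)"

text \<open>All sources of randomness take values in one type, so that they form a single family of
  random variables.\<close>

fun source_val ::
    "('w, 'c::finite, 'u::finite, 'm::finite) downlink \<Rightarrow> ('c, 'u) source \<Rightarrow> 'w \<Rightarrow> ('c, 'u, 'm) csi \<times> complex"
  where
    "source_val S (Channel t) \<omega> = ((chan S t \<omega>, est S t \<omega>), 0)"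
  | "source_val S (Symbol t l k n) \<omega> = (0, symb S t l k n \<omega>)"
  | "source_val S (Noise t l k n) \<omega> = (0, noise S t l k n \<omega>)"

lemma source_val_abs:
  "source_val S (Channel t) = (\<lambda>\<omega>. ((chan S t \<omega>, est S t \<omega>), 0))"
  "source_val S (Symbol t l k n) = (\<lambda>\<omega>. (0, symb S t l k n \<omega>))"
  "source_val S (Noise t l k n) = (\<lambda>\<omega>. (0, noise S t l k n \<omega>))"
  by (simp_all add: fun_eq_iff)

definition swap1 :: "nat \<Rightarrow> nat \<Rightarrow> nat"
  where "swap1 n m = (if m = n then 1 else if m = 1 then n else m)"

lemma swap1_swap1 [simp]: "swap1 n (swap1 n m) = m"
  by (simp add: swap1_def)

lemma swap1_1 [simp]: "swap1 n 1 = n"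
  by (auto simp: swap1_def)

lemma swap1_1_left [simp]: "swap1 1 m = m"
  by (simp add: swap1_def)

lemma inj_swap1: "inj (swap1 n)"
  by (metis injI swap1_swap1)

text \<open>Local labels use interval 0 and put the symbol under consideration at position 1; exchanging
  it with position \<open>n\<close> avoids any reindexing of product measures.\<close>

fun relabel :: "nat \<Rightarrow> nat \<Rightarrow> ('c, 'u) source \<Rightarrow> ('c, 'u) source"
  where
    "relabel t n (Channel _) = Channel t"
  | "relabel t n (Symbol _ l k m) = Symbol t l k (swap1 n m)"
  | "relabel t n (Noise _ l k m) = Noise t l k (swap1 n m)"

definition sample_sources :: "'c \<Rightarrow> 'u \<Rightarrow> nat set \<Rightarrow> ('c, 'u) source set"
  where "sample_sources l k B = (\<lambda>(l', k', m). Symbol 0 l' k' m) ` (UNIV \<times> UNIV \<times> B) \<union> Noise 0 l k ` B"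

abbreviation fresh :: "'c \<Rightarrow> 'u \<Rightarrow> ('c, 'u) source set"
  where "fresh l k \<equiv> sample_sources l k {1}"

definition past :: "('w, 'c::finite, 'u::finite, 'm::finite) downlink \<Rightarrow> 'c \<Rightarrow> 'u \<Rightarrow> ('c, 'u) source set"
  where "past S l k = insert (Channel 0) (sample_sources l k (data_idx S - {1}))"

definition gain ::
    "('w, 'c::finite, 'u::finite, 'm::finite) downlink \<Rightarrow> 'c \<Rightarrow> 'u \<Rightarrow> 'c \<Rightarrow> 'u \<Rightarrow> ('c, 'u, 'm) csi \<Rightarrow> complex"
  where "gain S l k l' k' h =
    complex_of_real (sqrt (rho S)) * cinner (fst h $ l' $ l $ k) (precoder S l' k' (snd h $ l'))"

definition sample ::
    "('w, 'c::finite, 'u::finite, 'm::finite) downlink \<Rightarrow> 'c \<Rightarrow> 'u \<Rightarrow> nat \<Rightarrow>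
      (('c, 'u) source \<Rightarrow> ('c, 'u, 'm) csi \<times> complex) \<Rightarrow> complex"
  where "sample S l k m \<xi> =
    (\<Sum>l'\<in>UNIV. \<Sum>k'\<in>UNIV. complex_of_real (sqrt (eta S l' k')) * gain S l k l' k' (fst (\<xi> (Channel 0)))
        * snd (\<xi> (Symbol 0 l' k' m)))
      + snd (\<xi> (Noise 0 l k m))"

definition equalizer ::
    "('w, 'c::finite, 'u::finite, 'm::finite) downlink \<Rightarrow> 'c \<Rightarrow> 'u \<Rightarrow> nat set \<Rightarrow> (nat \<Rightarrow> complex) \<Rightarrow> complex"
  where "equalizer S l k B y =
    (let q = 1 / (real (tauc S) - real (taup S) - 1) * (\<Sum>m\<in>B. (norm (y m))\<^sup>2)
     in if q > Theta S l k then complex_of_real (sqrt ((q - T_lk S l k 0) / eta S l k))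
        else (\<integral>\<omega>. alpha S 0 l k l k \<omega> \<partial>Om S))"

abbreviation est_gain ::
    "('w, 'c::finite, 'u::finite, 'm::finite) downlink \<Rightarrow> 'c \<Rightarrow> 'u \<Rightarrow>
      (('c, 'u) source \<Rightarrow> ('c, 'u, 'm) csi \<times> complex) \<Rightarrow> complex"
  where "est_gain S l k \<xi> \<equiv> equalizer S l k (data_idx S - {1}) (\<lambda>m. sample S l k m \<xi>)"

lemma inj_on_relabel:
  "inj_on (relabel t n) (past S l k \<union> fresh l k)"
  using inj_swap1[of n] by (auto simp: inj_on_def past_def sample_sources_def)

lemma finite_sample_sources [simp]: "finite B \<Longrightarrow> finite (sample_sources l k B :: ('c::finite, 'u::finite) source set)"
  by (simp add: sample_sources_def)

lemma finite_past [simp]: "finite (past S l k)"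
  by (simp add: past_def data_idx_def)

lemma past_fresh_disjoint: "past S l k \<inter> fresh l k = {}"
  by (auto simp: past_def sample_sources_def)

lemma sum_fresh:
  "(\<Sum>j\<in>fresh l k. f j) = (\<Sum>l'\<in>UNIV. \<Sum>k'\<in>UNIV. f (Symbol 0 l' k' 1)) + f (Noise 0 (l::'c::finite) (k::'u::finite) 1)"
proof -
  have e: "fresh l k = (\<lambda>(l', k'). Symbol 0 l' k' 1) ` (UNIV \<times> UNIV) \<union> {Noise 0 l k 1}"
    by (auto simp: sample_sources_def image_iff)
  have "(\<Sum>j\<in>(\<lambda>(l', k'). Symbol 0 l' k' 1) ` (UNIV \<times> UNIV). f j) = (\<Sum>(l', k')\<in>UNIV \<times> UNIV. f (Symbol 0 l' k' 1))"
    by (subst sum.reindex) (auto simp: inj_on_def split_beta)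
  also have "\<dots> = (\<Sum>l'\<in>UNIV. \<Sum>k'\<in>UNIV. f (Symbol 0 l' k' 1))"
    by (simp only: sum.cartesian_product)
  finally show ?thesis
    unfolding e by (subst sum.union_disjoint) auto
qed

lemma sum_split_user:
  fixes f :: "'c::finite \<Rightarrow> 'u::finite \<Rightarrow> 'a::comm_monoid_add"
  shows "(\<Sum>l'\<in>UNIV. \<Sum>k'\<in>UNIV. f l' k')
    = f l k + (\<Sum>k'\<in>UNIV - {k}. f l k') + (\<Sum>l'\<in>UNIV - {l}. \<Sum>k'\<in>UNIV. f l' k')"
  by (simp add: sum.remove[of UNIV l] sum.remove[of UNIV k "f l"])

context
  fixes S :: "('w, 'c::finite, 'u::finite, 'm::finite) downlink" and l :: 'c and k :: 'u
begin

lemma sample_restrict: "m \<in> data_idx S - {1} \<Longrightarrow> sample S l k m (restrict \<xi> (past S l k)) = sample S l k m \<xi>"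
  by (simp add: sample_def past_def sample_sources_def image_iff)

lemma est_gain_restrict: "est_gain S l k (restrict \<xi> (past S l k)) = est_gain S l k \<xi>"
  unfolding equalizer_def by (simp add: sample_restrict)

lemma Channel_past [simp]: "Channel 0 \<in> past S l k"
  by (simp add: past_def)

end

definition sinr_den ::
    "('w, 'c::finite, 'u::finite, 'm::finite) downlink \<Rightarrow> 'c \<Rightarrow> 'u \<Rightarrow> nat \<Rightarrow> nat \<Rightarrow> real"
  where "sinr_den S l k t n =
    cvar (Om S) (\<lambda>\<omega>. alpha S t l k l k \<omega> / alpha_bar S l k t n \<omega>)
     + (\<Sum>k'\<in>UNIV - {k}. eta S l k' / eta S l k *
          (\<integral>\<omega>. (norm (alpha S t l k l k' \<omega> / alpha_bar S l k t n \<omega>))\<^sup>2 \<partial>Om S))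
     + (\<Sum>l'\<in>UNIV - {l}. \<Sum>k'\<in>UNIV. eta S l' k' / eta S l k *
          (\<integral>\<omega>. (norm (alpha S t l k l' k' \<omega> / alpha_bar S l k t n \<omega>))\<^sup>2 \<partial>Om S))
     + sigma2 S / eta S l k * (\<integral>\<omega>. 1 / (norm (alpha_bar S l k t n \<omega>))\<^sup>2 \<partial>Om S)"

fun error_coeff ::
    "('w, 'c::finite, 'u::finite, 'm::finite) downlink \<Rightarrow> 'c \<Rightarrow> 'u \<Rightarrow> complex \<Rightarrow> ('c, 'u) source \<Rightarrow>
      complex \<times> (('c, 'u, 'm) csi) \<Rightarrow> complex"
  where
    "error_coeff S l k c (Symbol _ l' k' _) (b, h) = of_bool (l' = l \<and> k' = k)
        - c * complex_of_real (sqrt (eta S l' k') / sqrt (eta S l k)) * (gain S l k l' k' h / b)"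
  | "error_coeff S l k c (Noise _ _ _ _) (b, h) = - c * complex_of_real (1 / sqrt (eta S l k)) * (1 / b)"
  | "error_coeff S l k c (Channel _) (b, h) = 0"

lemma error_eq_sum:
  fixes S :: "('w, 'c::finite, 'u::finite, 'm::finite) downlink"
  shows "snd (\<xi> (Symbol 0 l k 1)) - c * (sample S l k 1 \<xi> / (complex_of_real (sqrt (eta S l k)) * b))
    = (\<Sum>j\<in>fresh l k. error_coeff S l k c j (b, fst (\<xi> (Channel 0))) * snd (\<xi> j))"
proof -
  have "(\<Sum>l'\<in>UNIV. \<Sum>k'\<in>UNIV. of_bool (l' = l \<and> k' = k) * snd (\<xi> (Symbol 0 l' k' 1))) = snd (\<xi> (Symbol 0 l k 1))"
    unfolding sum_split_user[of _ l k] by (auto intro!: sum.neutral)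
  note delta = this
  define r where "r = c / (complex_of_real (sqrt (eta S l k)) * b)"
  let ?h = "fst (\<xi> (Channel 0))"
  let ?s = "\<lambda>l' k'. complex_of_real (sqrt (eta S l' k')) * gain S l k l' k' ?h"
  have e1: "error_coeff S l k c (Symbol 0 l' k' 1) (b, ?h) = of_bool (l' = l \<and> k' = k) - r * ?s l' k'" for l' k'
    by (simp add: r_def)
  have e2: "error_coeff S l k c (Noise 0 l k 1) (b, ?h) = - r"
    by (simp add: r_def)
  have "(\<Sum>j\<in>fresh l k. error_coeff S l k c j (b, ?h) * snd (\<xi> j))
    = snd (\<xi> (Symbol 0 l k 1)) - r * sample S l k 1 \<xi>"
    unfolding sum_fresh e1 e2 sample_def left_diff_distrib sum_subtractf delta
    by (simp add: mult.assoc sum_distrib_left distrib_left)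
  then show ?thesis by (simp add: r_def)
qed

context mimo_downlink
begin

lemma one_data_idx: "1 \<in> data_idx S"
  using tau by (auto simp: data_idx_def)

lemma swap1_data_idx_iff: "n \<in> data_idx S \<Longrightarrow> swap1 n m \<in> data_idx S \<longleftrightarrow> m \<in> data_idx S"
  using one_data_idx by (auto simp: swap1_def)

lemma swap1_image: "n \<in> data_idx S \<Longrightarrow> swap1 n ` (data_idx S - {1}) = data_idx S - {n}"
proof -
  assume n: "n \<in> data_idx S"
  have D: "swap1 n ` data_idx S = data_idx S"
  proof
    show "swap1 n ` data_idx S \<subseteq> data_idx S" using swap1_data_idx_iff[OF n] by blast
    show "data_idx S \<subseteq> swap1 n ` data_idx S"
      using swap1_data_idx_iff[OF n] by (metis image_eqI subsetI swap1_swap1)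
  qed
  show ?thesis
    using image_set_diff[OF inj_swap1, of n "data_idx S" "{1}"] by (simp add: D)
qed

lemma relabel_sources:
  "n \<in> data_idx S \<Longrightarrow> relabel t n ` (past S l k \<union> fresh l k) \<subseteq> sources S"
  using one_data_idx by (auto simp: past_def sample_sources_def sources_def swap1_data_idx_iff)

lemma gain_measurable: "gain S l k l' k' \<in> borel_measurable borel"
  unfolding gain_def
  by (intro borel_measurable_times borel_measurable_const borel_measurable_cinner borel_measurable_vec_nth_borel
     borel_measurable_fst_borel measurable_ident measurable_compose[OF _ precoder_measurable] borel_measurable_snd_borel)
    (auto intro: measurable_ident)

lemma csi_measurable: "(\<lambda>\<omega>. (chan S t \<omega>, est S t \<omega>)) \<in> borel_measurable (Om S)"
  using chan_measurable est_measurable by (rule borel_measurable_Pair)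

lemma alpha_eq_gain: "alpha S t l k l' k' \<omega> = gain S l k l' k' (chan S t \<omega>, est S t \<omega>)"
  by (simp add: alpha_def gain_def prec_vec_def)

lemma alpha_measurable: "alpha S t l k l' k' \<in> borel_measurable (Om S)"
  unfolding alpha_eq_gain[abs_def] by (rule measurable_compose[OF csi_measurable gain_measurable])

lemma integral_csi_stationary:
  fixes g :: "('c, 'u, 'm) csi \<Rightarrow> 'b::{banach, second_countable_topology}"
  assumes "g \<in> borel_measurable borel"
  shows "(\<integral>\<omega>. g (chan S t \<omega>, est S t \<omega>) \<partial>Om S) = (\<integral>\<omega>. g (chan S t' \<omega>, est S t' \<omega>) \<partial>Om S)"
  using integral_distr[OF csi_measurable assms, of t] integral_distr[OF csi_measurable assms, of t']
    chan_stationary[of t t'] by simp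

lemma alpha_mean_stationary: "(\<integral>\<omega>. alpha S t l k l' k' \<omega> \<partial>Om S) = (\<integral>\<omega>. alpha S 0 l k l' k' \<omega> \<partial>Om S)"
  unfolding alpha_eq_gain by (rule integral_csi_stationary[OF gain_measurable])

lemma T_lk_stationary: "T_lk S l k t = T_lk S l k 0"
proof -
  have "(\<integral>\<omega>. (norm (alpha S t l k l' k' \<omega>))\<^sup>2 \<partial>Om S) = (\<integral>\<omega>. (norm (alpha S 0 l k l' k' \<omega>))\<^sup>2 \<partial>Om S)" for l' k'
    unfolding alpha_eq_gain
    using gain_measurable by (intro integral_csi_stationary[where g = "\<lambda>h. (norm (gain S l k l' k' h))\<^sup>2"]) measurable
  then show ?thesis by (simp add: T_lk_def)
qed

lemma source_val_measurable: "i \<in> sources S \<Longrightarrow> source_val S i \<in> borel_measurable (Om S)"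
  by (auto simp: sources_def source_val_abs intro!: borel_measurable_Pair csi_measurable symb_measurable noise_measurable)

lemma indep_vars_source_val: "indep_vars (\<lambda>_. borel) (source_val S) (sources S)"
  unfolding indep_vars_def2
proof (intro conjI ballI indep_sets_mono_sets[OF sources_indep])
  fix i assume i: "i \<in> sources S"
  show "random_variable borel (source_val S i)" using i by (rule source_val_measurable)
  show "{source_val S i -` A \<inter> space (Om S) |A. A \<in> sets borel} \<subseteq> source_events S i"
  proof safe
    fix A :: "(('c, 'u, 'm) csi \<times> complex) set" assume A: "A \<in> sets borel"
    have 1: "(\<lambda>h. (h, 0)) -` A \<in> sets borel" "Pair 0 -` A \<in> sets borel"
      using measurable_sets[OF _ A, of "\<lambda>h. (h, 0)" borel] measurable_sets[OF _ A, of "Pair 0" borel]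
      by (auto intro!: borel_measurable_Pair)
    show "source_val S i -` A \<inter> space (Om S) \<in> source_events S i"
    proof (cases i)
      case (Channel t)
      then have "source_val S i -` A \<inter> space (Om S)
        = (\<lambda>\<omega>. (chan S t \<omega>, est S t \<omega>)) -` ((\<lambda>h. (h, 0)) -` A) \<inter> space (Om S)" by auto
      then show ?thesis using in_vimage_algebra[OF 1(1)] Channel by simp
    next
      case (Symbol t l k n)
      then have "source_val S i -` A \<inter> space (Om S) = symb S t l k n -` (Pair 0 -` A) \<inter> space (Om S)" by auto
      then show ?thesis using in_vimage_algebra[OF 1(2)] Symbol by simp
    next
      case (Noise t l k n)
      then have "source_val S i -` A \<inter> space (Om S) = noise S t l k n -` (Pair 0 -` A) \<inter> space (Om S)" by auto
      then show ?thesis using in_vimage_algebra[OF 1(2)] Noise by simp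
    qed
  qed
qed

lemma indep_vars_relabel:
  assumes "n \<in> data_idx S" "I \<subseteq> past S l k \<union> fresh l k"
  shows "indep_vars (\<lambda>_. borel) (\<lambda>i. source_val S (relabel t n i)) I"
proof -
  have sub: "relabel t n ` I \<subseteq> sources S" using relabel_sources assms by blast
  have "indep_vars (\<lambda>_. borel) (source_val S) (relabel t n ` I)"
    by (rule indep_vars_subset[OF indep_vars_source_val sub])
  then show ?thesis
    using indep_sets_reindex[OF _ inj_on_subset[OF inj_on_relabel assms(2)]]
    by (auto simp: indep_vars_def2)
qed

lemma distr_source_val_relabel:
  assumes n: "n \<in> data_idx S" and i: "i \<in> past S l k \<union> fresh l k"
  shows "distr (Om S) borel (source_val S (relabel t n i)) = distr (Om S) borel (source_val S i)"
proof -
  have P: "(\<lambda>h::('c, 'u, 'm) csi. (h, 0::complex)) \<in> borel_measurable borel"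
    "Pair (0::('c, 'u, 'm) csi) \<in> borel_measurable (borel :: complex measure)"
    by (auto intro!: borel_measurable_Pair)
  have D: "m \<in> data_idx S" if "i = Symbol t l k m \<or> i = Noise t l k m" for t l k m
    using i that one_data_idx by (auto simp: past_def sample_sources_def)
  show ?thesis
  proof (cases i)
    case (Channel t')
    have "distr (Om S) borel (source_val S (Channel s)) = distr (distr (Om S) borel (\<lambda>\<omega>. (chan S s \<omega>, est S s \<omega>))) borel (\<lambda>h. (h, 0))" for s
      by (subst distr_distr[OF P(1) csi_measurable]) (simp add: o_def source_val_abs)
    then show ?thesis using Channel chan_stationary[of t t'] by simp
  next
    case (Symbol t' l k m)
    have "distr (Om S) borel (source_val S (Symbol s l k j)) = distr (distr (Om S) borel (symb S s l k j)) borel (Pair 0)"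
      if "j \<in> data_idx S" for s j
      using that by (subst distr_distr[OF P(2) symb_measurable]) (simp_all add: o_def source_val_abs)
    then show ?thesis using Symbol D[of t' l k m] n swap1_data_idx_iff[of n m] symb_identical[of "swap1 n m" m t l k t'] by simp
  next
    case (Noise t' l k m)
    have "distr (Om S) borel (source_val S (Noise s l k j)) = distr (cn_law (sigma2 S)) borel (Pair 0)"
      if "j \<in> data_idx S" for s j
      unfolding noise_law[OF that, of s l k, symmetric]
      using that by (subst distr_distr[OF P(2) noise_measurable]) (simp_all add: o_def source_val_abs)
    then show ?thesis using Noise D[of t' l k m] n swap1_data_idx_iff[of n m] by simp
  qed
qed

lemma indep_vars_local: "I \<subseteq> past S l k \<union> fresh l k \<Longrightarrow> indep_vars (\<lambda>_. borel) (source_val S) I"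
  using one_data_idx
  by (intro indep_vars_subset[OF indep_vars_source_val])
    (auto simp: past_def sample_sources_def sources_def)

lemma distr_past:
  assumes P: "prob_space P" and W: "prob_space.indep_vars P (\<lambda>_. borel) W (past S l k)"
    and law: "\<And>i. i \<in> past S l k \<Longrightarrow> distr P borel (W i) = distr (Om S) borel (source_val S i)"
  shows "distr P (PiM (past S l k) (\<lambda>_. borel)) (\<lambda>p. \<lambda>i\<in>past S l k. W i p)
    = distr (Om S) (PiM (past S l k) (\<lambda>_. borel)) (\<lambda>\<omega>. \<lambda>i\<in>past S l k. source_val S i \<omega>)"
proof -
  interpret P: prob_space P by fact
  have ne: "past S l k \<noteq> {}" by (auto simp: past_def)
  have "distr P (PiM (past S l k) (\<lambda>_. borel)) (\<lambda>p. \<lambda>i\<in>past S l k. W i p) = PiM (past S l k) (\<lambda>i. distr P borel (W i))"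
    using P.indep_vars_iff_distr_eq_PiM'[OF ne, of W "\<lambda>_. borel"] W by (simp add: P.indep_vars_def)
  also have "\<dots> = PiM (past S l k) (\<lambda>i. distr (Om S) borel (source_val S i))"
    by (intro PiM_cong law refl)
  also have "\<dots> = distr (Om S) (PiM (past S l k) (\<lambda>_. borel)) (\<lambda>\<omega>. \<lambda>i\<in>past S l k. source_val S i \<omega>)"
    using indep_vars_iff_distr_eq_PiM'[OF ne, of "source_val S" "\<lambda>_. borel"] indep_vars_local[of "past S l k" l k]
    by (simp add: indep_vars_def)
  finally show ?thesis .
qed

lemma past_transfer:
  fixes g :: "(('c, 'u) source \<Rightarrow> ('c, 'u, 'm) csi \<times> complex) \<Rightarrow> 'b::{banach, second_countable_topology}"
  assumes P: "prob_space P" and W: "prob_space.indep_vars P (\<lambda>_. borel) W (past S l k)"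
    and law: "\<And>i. i \<in> past S l k \<Longrightarrow> distr P borel (W i) = distr (Om S) borel (source_val S i)"
    and g: "g \<in> borel_measurable (PiM (past S l k) (\<lambda>_. borel))"
    and gr: "\<And>\<xi>. g (restrict \<xi> (past S l k)) = g \<xi>"
  shows "(\<integral>p. g (\<lambda>i. W i p) \<partial>P) = (\<integral>\<omega>. g (\<lambda>i. source_val S i \<omega>) \<partial>Om S)"
    and "integrable P (\<lambda>p. g (\<lambda>i. W i p)) \<longleftrightarrow> integrable (Om S) (\<lambda>\<omega>. g (\<lambda>i. source_val S i \<omega>))"
proof -
  interpret P: prob_space P by fact
  have m1: "(\<lambda>p. \<lambda>i\<in>past S l k. W i p) \<in> measurable P (PiM (past S l k) (\<lambda>_. borel))"
    using W by (intro measurable_restrict) (simp add: P.indep_vars_def)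
  have m2: "(\<lambda>p. \<lambda>i\<in>past S l k. source_val S i p) \<in> measurable (Om S) (PiM (past S l k) (\<lambda>_. borel))"
    using indep_vars_local[of "past S l k" l k] by (intro measurable_restrict) (simp add: indep_vars_def)
  note d = distr_past[OF P W law]
  show "(\<integral>p. g (\<lambda>i. W i p) \<partial>P) = (\<integral>\<omega>. g (\<lambda>i. source_val S i \<omega>) \<partial>Om S)"
    using integral_distr[OF m1 g] integral_distr[OF m2 g] d by (simp add: gr)
  show "integrable P (\<lambda>p. g (\<lambda>i. W i p)) \<longleftrightarrow> integrable (Om S) (\<lambda>\<omega>. g (\<lambda>i. source_val S i \<omega>))"
    using integrable_distr_eq[OF m1 g] integrable_distr_eq[OF m2 g] d by (simp add: gr)
qed

lemma gain_past_measurable: "(\<lambda>\<xi>. gain S l k l' k' (fst (\<xi> (Channel 0)))) \<in> borel_measurable (PiM (past S l k) (\<lambda>_. borel))"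
  by (intro measurable_compose[OF borel_measurable_fst_borel gain_measurable] measurable_component_singleton) simp

lemma sample_measurable:
  assumes "m \<in> data_idx S - {1}"
  shows "sample S l k m \<in> borel_measurable (PiM (past S l k) (\<lambda>_. borel))"
proof -
  have [measurable]: "(\<lambda>\<xi>. snd (\<xi> (Symbol 0 l' k' m))) \<in> borel_measurable (PiM (past S l k) (\<lambda>_. borel :: (('c, 'u, 'm) csi \<times> complex) measure))"
    "(\<lambda>\<xi>. snd (\<xi> (Noise 0 l k m))) \<in> borel_measurable (PiM (past S l k) (\<lambda>_. borel :: (('c, 'u, 'm) csi \<times> complex) measure))" for l' k'
    using assms by (auto simp: past_def sample_sources_def image_iff intro!: borel_measurable_snd_borel measurable_component_singleton)
  note gain_past_measurable[measurable]
  show ?thesis unfolding sample_def by measurable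
qed

lemma equalizer_measurable:
  assumes [measurable]: "\<And>m. m \<in> B \<Longrightarrow> y m \<in> borel_measurable M"
  shows "(\<lambda>x. equalizer S l k B (\<lambda>m. y m x)) \<in> borel_measurable M"
  unfolding equalizer_def Let_def by measurable

lemma est_gain_measurable: "est_gain S l k \<in> borel_measurable (PiM (past S l k) (\<lambda>_. borel))"
  by (rule equalizer_measurable) (rule sample_measurable)

lemma sample_source_val:
  "sample S l k m (\<lambda>i. source_val S (relabel t n i) \<omega>) = y_lk S l k t (swap1 n m) \<omega>"
  by (simp add: sample_def y_lk_def received_def alpha_eq_gain)

lemma equalizer_reindex:
  assumes "n \<in> data_idx S"
  shows "equalizer S l k (data_idx S - {1}) (\<lambda>m. y (swap1 n m)) = equalizer S l k (data_idx S - {n}) y"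
proof -
  have "(\<Sum>m\<in>data_idx S - {1}. (norm (y (swap1 n m)))\<^sup>2) = (\<Sum>m\<in>data_idx S - {n}. (norm (y m))\<^sup>2)"
    unfolding swap1_image[OF assms, symmetric]
    by (subst sum.reindex) (auto intro: inj_on_subset[OF inj_swap1])
  then show ?thesis by (simp add: equalizer_def)
qed

lemma est_gain_source_val:
  assumes "n \<in> data_idx S"
  shows "est_gain S l k (\<lambda>i. source_val S (relabel t n i) \<omega>) = alpha_bar S l k t n \<omega>"
  unfolding sample_source_val equalizer_reindex[OF assms, of l k "\<lambda>m. y_lk S l k t m \<omega>"]
  by (simp add: equalizer_def alpha_bar_def xi_lk_def Let_def alpha_mean_stationary[of t] T_lk_stationary[of l k t])

lemma source_val_relabel_0_1:
  "i \<in> past S l k \<union> fresh l k \<Longrightarrow> relabel 0 1 i = i"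
  by (auto simp: past_def sample_sources_def)

lemma est_gain_source_val_0_1: "est_gain S l k (\<lambda>i. source_val S i \<omega>) = alpha_bar S l k 0 1 \<omega>"
proof -
  have r: "restrict (\<lambda>i. source_val S (relabel 0 1 i) \<omega>) (past S l k) = restrict (\<lambda>i. source_val S i \<omega>) (past S l k)"
    by (intro restrict_ext) (use source_val_relabel_0_1[of _ l k] in simp)
  show ?thesis
    using est_gain_source_val[OF one_data_idx, of l k 0 \<omega>]
      est_gain_restrict[of S l k "\<lambda>i. source_val S (relabel 0 1 i) \<omega>"] est_gain_restrict[of S l k "\<lambda>i. source_val S i \<omega>"]
    by (simp only: r)
qed

lemma equalized_moment_transfer:
  assumes P: "prob_space P" and W: "prob_space.indep_vars P (\<lambda>_. borel) W (past S l k)"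
    and law: "\<forall>i\<in>past S l k. distr P borel (W i) = distr (Om S) borel (source_val S i)"
    and f[measurable]: "f \<in> borel_measurable (borel \<Otimes>\<^sub>M borel)"
  shows "(\<integral>p. f (gain S l k l' k' (fst (W (Channel 0) p)), est_gain S l k (\<lambda>i. W i p)) \<partial>P)
      = (\<integral>\<omega>. f (alpha S 0 l k l' k' \<omega>, alpha_bar S l k 0 1 \<omega>) \<partial>Om S)" (is ?eq)
    and "integrable P (\<lambda>p. f (gain S l k l' k' (fst (W (Channel 0) p)), est_gain S l k (\<lambda>i. W i p)))
      \<longleftrightarrow> integrable (Om S) (\<lambda>\<omega>. f (alpha S 0 l k l' k' \<omega>, alpha_bar S l k 0 1 \<omega>) :: 'b::{banach, second_countable_topology})" (is ?int)
proof -
  let ?g = "\<lambda>\<xi>. f (gain S l k l' k' (fst (\<xi> (Channel 0))), est_gain S l k \<xi>)"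
  note gain_past_measurable[measurable] est_gain_measurable[measurable]
  have g: "?g \<in> borel_measurable (PiM (past S l k) (\<lambda>_. borel))" by measurable
  have gr: "?g (restrict \<xi> (past S l k)) = ?g \<xi>" for \<xi>
    by (simp only: est_gain_restrict restrict_apply' Channel_past)
  note * = past_transfer[OF P W law[rule_format] g gr, unfolded est_gain_source_val_0_1 source_val.simps fst_conv alpha_eq_gain[symmetric]]
  show ?eq by (rule *(1))
  show ?int by (rule *(2))
qed

lemma SINR_0_1:
  assumes n: "n \<in> data_idx S"
  shows "SINR S l k t n = SINR S l k 0 1"
proof -
  have tr: "(\<integral>\<omega>. f (alpha S t l k l' k' \<omega>, alpha_bar S l k t n \<omega>) \<partial>Om S)
      = (\<integral>\<omega>. f (alpha S 0 l k l' k' \<omega>, alpha_bar S l k 0 1 \<omega>) \<partial>Om S)"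
    if "f \<in> borel_measurable (borel \<Otimes>\<^sub>M borel)"
    for f :: "complex \<times> complex \<Rightarrow> 'b::{banach, second_countable_topology}" and l' k'
  proof -
    have i: "indep_vars (\<lambda>_. borel) (\<lambda>i. source_val S (relabel t n i)) (past S l k)"
      using n by (rule indep_vars_relabel) auto
    have d: "\<forall>i\<in>past S l k. distr (Om S) borel (source_val S (relabel t n i)) = distr (Om S) borel (source_val S i)"
      using n by (intro ballI distr_source_val_relabel) auto
    show ?thesis
      using equalized_moment_transfer(1)[OF prob_space_axioms i d that, of l' k']
      unfolding est_gain_source_val[OF n] by (simp add: alpha_eq_gain)
  qed
  have 1: "(\<integral>\<omega>. alpha S t l k l' k' \<omega> / alpha_bar S l k t n \<omega> \<partial>Om S) = (\<integral>\<omega>. alpha S 0 l k l' k' \<omega> / alpha_bar S l k 0 1 \<omega> \<partial>Om S)" for l' k'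
    using tr[of "\<lambda>(a, b). a / b" l' k'] by simp
  have 2: "(\<integral>\<omega>. (norm (alpha S t l k l' k' \<omega> / alpha_bar S l k t n \<omega> - c))\<^sup>2 \<partial>Om S)
      = (\<integral>\<omega>. (norm (alpha S 0 l k l' k' \<omega> / alpha_bar S l k 0 1 \<omega> - c))\<^sup>2 \<partial>Om S)" for l' k' c
    using tr[of "\<lambda>(a, b). (norm (a / b - c))\<^sup>2" l' k'] by simp
  have 3: "(\<integral>\<omega>. 1 / (norm (alpha_bar S l k t n \<omega>))\<^sup>2 \<partial>Om S) = (\<integral>\<omega>. 1 / (norm (alpha_bar S l k 0 1 \<omega>))\<^sup>2 \<partial>Om S)"
    using tr[of "\<lambda>(a, b). 1 / (norm b)\<^sup>2" l k] by simp
  show ?thesis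
    unfolding SINR_def cvar_def 1 2 3 using 2[of _ _ 0] by simp
qed

lemma alpha_bar_lower:
  assumes "0 < eta S l k"
  obtains B where "0 \<le> B" "\<And>\<omega>. norm (1 / alpha_bar S l k 0 1 \<omega>) \<le> B"
proof
  let ?E = "\<integral>\<omega>. alpha S 0 l k l k \<omega> \<partial>Om S"
  let ?c = "sqrt ((Theta S l k - T_lk S l k 0) / eta S l k)"
  have c: "0 < ?c" using Theta_above[of l k 0] assms by simp
  show "0 \<le> 1 / ?c + norm (1 / ?E)" using c by simp
  fix \<omega>
  show "norm (1 / alpha_bar S l k 0 1 \<omega>) \<le> 1 / ?c + norm (1 / ?E)"
  proof (cases "xi_lk S l k 0 1 \<omega> > Theta S l k")
    case True
    let ?d = "sqrt ((xi_lk S l k 0 1 \<omega> - T_lk S l k 0) / eta S l k)"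
    have cd: "?c \<le> ?d" using True assms by (intro real_sqrt_le_mono divide_right_mono) auto
    have "norm (1 / alpha_bar S l k 0 1 \<omega>) = 1 / ?d"
      using True c cd by (simp add: alpha_bar_def norm_divide)
    also have "\<dots> \<le> 1 / ?c" using c cd by (intro divide_left_mono mult_pos_pos) auto
    also have "\<dots> \<le> 1 / ?c + norm (1 / ?E)" by simp
    finally show ?thesis .
  qed (use c in \<open>auto simp: alpha_bar_def\<close>)
qed

lemma alpha_bar_measurable: "n \<in> data_idx S \<Longrightarrow> alpha_bar S l k t n \<in> borel_measurable (Om S)"
proof -
  assume n: "n \<in> data_idx S"
  have "(\<lambda>\<omega>. \<lambda>i\<in>past S l k. source_val S (relabel t n i) \<omega>) \<in> measurable (Om S) (PiM (past S l k) (\<lambda>_. borel))"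
    using indep_vars_relabel[OF n, of "past S l k" l k t] by (intro measurable_restrict) (simp add: indep_vars_def)
  from measurable_compose[OF this est_gain_measurable]
  show ?thesis unfolding est_gain_restrict est_gain_source_val[OF n] .
qed

lemma integrable_equalized:
  assumes "0 < eta S l k"
  shows "integrable (Om S) (\<lambda>\<omega>. (norm (alpha S 0 l k l' k' \<omega> / alpha_bar S l k 0 1 \<omega>))\<^sup>2)"
    and "integrable (Om S) (\<lambda>\<omega>. (norm (1 / alpha_bar S l k 0 1 \<omega>))\<^sup>2)"
    and "integrable (Om S) (\<lambda>\<omega>. alpha S 0 l k l' k' \<omega> / alpha_bar S l k 0 1 \<omega>)"
proof -
  obtain B where B: "0 \<le> B" "\<And>\<omega>. norm (1 / alpha_bar S l k 0 1 \<omega>) \<le> B"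
    using alpha_bar_lower[OF assms] by metis
  note [measurable] = alpha_bar_measurable[OF one_data_idx] alpha_measurable
  have B2: "(norm (1 / alpha_bar S l k 0 1 \<omega>))\<^sup>2 \<le> B\<^sup>2" for \<omega>
    using B by (intro power_mono) auto
  show "integrable (Om S) (\<lambda>\<omega>. (norm (1 / alpha_bar S l k 0 1 \<omega>))\<^sup>2)"
    using B2 by (intro integrable_const_bound[of _ "B\<^sup>2"]) auto
  show i: "integrable (Om S) (\<lambda>\<omega>. (norm (alpha S 0 l k l' k' \<omega> / alpha_bar S l k 0 1 \<omega>))\<^sup>2)"
  proof (rule Bochner_Integration.integrable_bound)
    show "integrable (Om S) (\<lambda>\<omega>. B\<^sup>2 * (norm (alpha S 0 l k l' k' \<omega>))\<^sup>2)"
      by (intro integrable_mult_right alpha_square_integrable)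
    have "(norm (alpha S 0 l k l' k' \<omega> / alpha_bar S l k 0 1 \<omega>))\<^sup>2
        = (norm (1 / alpha_bar S l k 0 1 \<omega>))\<^sup>2 * (norm (alpha S 0 l k l' k' \<omega>))\<^sup>2" for \<omega>
      by (simp add: norm_divide power_divide)
    then show "AE \<omega> in Om S. norm ((norm (alpha S 0 l k l' k' \<omega> / alpha_bar S l k 0 1 \<omega>))\<^sup>2) \<le> norm (B\<^sup>2 * (norm (alpha S 0 l k l' k' \<omega>))\<^sup>2)"
      by (auto intro!: AE_I2 mult_right_mono B2)
  qed measurable
  show "integrable (Om S) (\<lambda>\<omega>. alpha S 0 l k l' k' \<omega> / alpha_bar S l k 0 1 \<omega>)"
    by (rule integrable_of_norm2[OF _ i]) measurable
qed

lemma error_second_moment: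
  fixes W :: "('c, 'u) source \<Rightarrow> 'p \<Rightarrow> ('c, 'u, 'm) csi \<times> complex"
  assumes eta: "0 < eta S l k" and P: "prob_space P"
    and W: "prob_space.indep_vars P (\<lambda>_. borel) W (past S l k \<union> fresh l k)"
    and law: "\<forall>i\<in>past S l k. distr P borel (W i) = distr (Om S) borel (source_val S i)"
    and u2: "\<And>j. j \<in> fresh l k \<Longrightarrow> integrable P (\<lambda>p. (norm (snd (W j p)))\<^sup>2)"
    and mean: "\<And>j. j \<in> fresh l k \<Longrightarrow> (\<integral>p. snd (W j p) \<partial>P) = 0"
    and sym: "\<And>l' k'. (\<integral>p. (norm (snd (W (Symbol 0 l' k' 1) p)))\<^sup>2 \<partial>P) = 1"
    and noi: "(\<integral>p. (norm (snd (W (Noise 0 l k 1) p)))\<^sup>2 \<partial>P) = sigma2 S"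
    and m: "m = (\<integral>\<omega>. alpha S 0 l k l k \<omega> / alpha_bar S l k 0 1 \<omega> \<partial>Om S)"
    and F: "F = (\<lambda>p. (norm (snd (W (Symbol 0 l k 1) p) - c * (sample S l k 1 (\<lambda>i. W i p)
        / (complex_of_real (sqrt (eta S l k)) * est_gain S l k (\<lambda>i. W i p)))))\<^sup>2)"
  shows "integrable P F"
    and "(\<integral>p. F p \<partial>P) = 1 - 2 * Re (c * m) + (norm c)\<^sup>2 * ((norm m)\<^sup>2 + sinr_den S l k 0 1)"
proof -
  interpret P: prob_space P by fact
  let ?A = "\<lambda>l' k' \<omega>. alpha S 0 l k l' k' \<omega> / alpha_bar S l k 0 1 \<omega>"
  let ?e = "\<lambda>j \<xi>. error_coeff S l k c j (est_gain S l k \<xi>, fst (\<xi> (Channel 0)))"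
  define b where "b j p = ?e j (\<lambda>i. W i p)" for j p
  define u where "u j p = snd (W j p)" for j p
  have Wm: "W i \<in> borel_measurable P" if "i \<in> past S l k \<union> fresh l k" for i
    using W that by (simp add: P.indep_vars_def)
  have Wp: "P.indep_vars (\<lambda>_. borel) W (past S l k)" by (rule P.indep_vars_subset[OF W]) auto
  have em: "?e j \<in> borel_measurable (PiM (past S l k) (\<lambda>_. borel))" for j
  proof -
    note gain_past_measurable[measurable] est_gain_measurable[measurable]
    show ?thesis by (cases j) (simp_all only: error_coeff.simps, measurable)
  qed
  have er: "?e j (\<lambda>i\<in>past S l k. W i p) = b j p" for j p
    unfolding b_def est_gain_restrict by simp
  have rm: "(\<lambda>p. \<lambda>i\<in>past S l k. W i p) \<in> measurable P (PiM (past S l k) (\<lambda>_. borel))"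
    using Wm by (intro measurable_restrict) auto
  have bm: "b j \<in> borel_measurable P" for j
    using measurable_compose[OF rm em[of j]] unfolding er .
  have um: "u j \<in> borel_measurable P" if "j \<in> fresh l k" for j
    unfolding u_def using Wm that by (intro borel_measurable_snd_borel) auto
  have ui: "integrable P (u j)" if "j \<in> fresh l k" for j
    using P.integrable_of_norm2[OF um[OF that]] u2[OF that] by (simp add: u_def)
  note ie = integrable_equalized[OF eta]
  have norm2: "(norm (0 - c * complex_of_real (sqrt x / sqrt y) * z))\<^sup>2 = (norm c)\<^sup>2 * (x / y * (norm z)\<^sup>2)"
    if "0 \<le> x" "0 \<le> y" for x y z
    using that by (simp add: norm_mult norm_divide power_mult_distrib power_divide)
  have bN: "integrable P (\<lambda>p. (norm (b (Noise t' l' k' m') p))\<^sup>2)"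
    "(\<integral>p. (norm (b (Noise t' l' k' m') p))\<^sup>2 \<partial>P)
      = (norm c)\<^sup>2 * (1 / eta S l k * (\<integral>\<omega>. 1 / (norm (alpha_bar S l k 0 1 \<omega>))\<^sup>2 \<partial>Om S))" for t' l' k' m'
  proof -
    have e: "(norm (b (Noise t' l' k' m') p))\<^sup>2
      = (norm c)\<^sup>2 * (1 / eta S l k * (norm (1 / est_gain S l k (\<lambda>i. W i p)))\<^sup>2)" for p
      using norm2[of 1 "eta S l k" "1 / est_gain S l k (\<lambda>i. W i p)"] eta by (simp add: b_def)
    have [measurable]: "(\<lambda>(a::complex, b::complex). (norm (1 / b))\<^sup>2) \<in> borel_measurable (borel \<Otimes>\<^sub>M borel)" by measurable
    note t = equalized_moment_transfer[OF P Wp law this, of l k, unfolded prod.case]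
    have i: "integrable P (\<lambda>p. (norm (1 / est_gain S l k (\<lambda>i. W i p)))\<^sup>2)" unfolding t(2) by (rule ie(2))
    show "integrable P (\<lambda>p. (norm (b (Noise t' l' k' m') p))\<^sup>2)"
      unfolding e using i by simp
    show "(\<integral>p. (norm (b (Noise t' l' k' m') p))\<^sup>2 \<partial>P)
      = (norm c)\<^sup>2 * (1 / eta S l k * (\<integral>\<omega>. 1 / (norm (alpha_bar S l k 0 1 \<omega>))\<^sup>2 \<partial>Om S))"
      unfolding e integral_mult_right_zero t(1) by (simp add: norm_divide power_divide)
  qed
  have bO: "integrable P (\<lambda>p. (norm (b (Symbol t' l' k' m') p))\<^sup>2)"
    "(\<integral>p. (norm (b (Symbol t' l' k' m') p))\<^sup>2 \<partial>P)
      = (norm c)\<^sup>2 * (eta S l' k' / eta S l k * (\<integral>\<omega>. (norm (?A l' k' \<omega>))\<^sup>2 \<partial>Om S))"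
    if "\<not> (l' = l \<and> k' = k)" for t' l' k' m'
  proof -
    have e: "(norm (b (Symbol t' l' k' m') p))\<^sup>2 = (norm c)\<^sup>2 * (eta S l' k' / eta S l k
        * (norm (gain S l k l' k' (fst (W (Channel 0) p)) / est_gain S l k (\<lambda>i. W i p)))\<^sup>2)" for p
      using norm2[of "eta S l' k'" "eta S l k" "gain S l k l' k' (fst (W (Channel 0) p)) / est_gain S l k (\<lambda>i. W i p)"]
        eta eta_range[of l' k'] that by (simp only: b_def error_coeff.simps of_bool_eq simp_thms)
    have [measurable]: "(\<lambda>(a::complex, b::complex). (norm (a / b))\<^sup>2) \<in> borel_measurable (borel \<Otimes>\<^sub>M borel)" by measurable
    note t = equalized_moment_transfer[OF P Wp law this, of l' k', unfolded prod.case]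
    have i: "integrable P (\<lambda>p. (norm (gain S l k l' k' (fst (W (Channel 0) p)) / est_gain S l k (\<lambda>i. W i p)))\<^sup>2)"
      unfolding t(2) by (rule ie(1))
    show "integrable P (\<lambda>p. (norm (b (Symbol t' l' k' m') p))\<^sup>2)"
      unfolding e by (intro integrable_mult_right i)
    show "(\<integral>p. (norm (b (Symbol t' l' k' m') p))\<^sup>2 \<partial>P)
      = (norm c)\<^sup>2 * (eta S l' k' / eta S l k * (\<integral>\<omega>. (norm (?A l' k' \<omega>))\<^sup>2 \<partial>Om S))"
      unfolding e integral_mult_right_zero t(1) ..
  qed
  have bS: "integrable P (\<lambda>p. (norm (b (Symbol t' l k m') p))\<^sup>2)"
    "(\<integral>p. (norm (b (Symbol t' l k m') p))\<^sup>2 \<partial>P)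
      = 1 - 2 * Re (c * m) + (norm c)\<^sup>2 * (cvar (Om S) (?A l k) + (norm m)\<^sup>2)" for t' m'
  proof -
    have e: "(norm (b (Symbol t' l k m') p))\<^sup>2
      = (norm (1 - c * (gain S l k l k (fst (W (Channel 0) p)) / est_gain S l k (\<lambda>i. W i p))))\<^sup>2" for p
      using eta by (simp add: b_def)
    have [measurable]: "(\<lambda>(a::complex, b::complex). (norm (1 - c * (a / b)))\<^sup>2) \<in> borel_measurable (borel \<Otimes>\<^sub>M borel)" by measurable
    note t = equalized_moment_transfer[OF P Wp law this, of l k, unfolded prod.case]
    have i: "integrable (Om S) (\<lambda>\<omega>. Re (c * ?A l k \<omega>))" by (intro integrable_Re integrable_mult_right ie(3))
    have r: "(\<integral>\<omega>. Re (c * ?A l k \<omega>) \<partial>Om S) = Re (c * m)"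
      unfolding m by (subst integral_Re) (auto intro: integrable_mult_right ie(3) simp del: times_divide_eq_right)
    show "integrable P (\<lambda>p. (norm (b (Symbol t' l k m') p))\<^sup>2)"
      unfolding e t(2) unfolding norm2_one_minus
      by (intro Bochner_Integration.integrable_add Bochner_Integration.integrable_diff integrable_const integrable_mult_right i ie(1))
    have "(\<integral>p. (norm (b (Symbol t' l k m') p))\<^sup>2 \<partial>P)
      = (\<integral>\<omega>. 1 - 2 * Re (c * ?A l k \<omega>) + (norm c)\<^sup>2 * (norm (?A l k \<omega>))\<^sup>2 \<partial>Om S)"
      unfolding e t(1) unfolding norm2_one_minus ..
    also have "\<dots> = (\<integral>\<omega>. 1 - 2 * Re (c * ?A l k \<omega>) \<partial>Om S) + (\<integral>\<omega>. (norm c)\<^sup>2 * (norm (?A l k \<omega>))\<^sup>2 \<partial>Om S)"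
      by (intro Bochner_Integration.integral_add Bochner_Integration.integrable_diff integrable_const integrable_mult_right i ie(1))
    also have "(\<integral>\<omega>. 1 - 2 * Re (c * ?A l k \<omega>) \<partial>Om S) = (\<integral>\<omega>. 1 \<partial>Om S) - (\<integral>\<omega>. 2 * Re (c * ?A l k \<omega>) \<partial>Om S)"
      by (intro Bochner_Integration.integral_diff integrable_const integrable_mult_right i)
    also have "(\<integral>\<omega>. (norm c)\<^sup>2 * (norm (?A l k \<omega>))\<^sup>2 \<partial>Om S) = (norm c)\<^sup>2 * (cvar (Om S) (?A l k) + (norm m)\<^sup>2)"
      unfolding integral_mult_right_zero integral_norm2_deviation[OF ie(3,1)] m ..
    finally show "(\<integral>p. (norm (b (Symbol t' l k m') p))\<^sup>2 \<partial>P)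
      = 1 - 2 * Re (c * m) + (norm c)\<^sup>2 * (cvar (Om S) (?A l k) + (norm m)\<^sup>2)"
      unfolding integral_mult_right_zero r by (simp add: prob_space)
  qed
  have b2: "integrable P (\<lambda>p. (norm (b j p))\<^sup>2)" for j
  proof (cases j)
    case (Symbol t' l' k' m')
    then show ?thesis using bS(1) bO(1) by (cases "l' = l \<and> k' = k") auto
  qed (use bN in \<open>auto simp: b_def\<close>)
  have ind: "P.indep_var borel (\<lambda>p. b i p * cnj (b j p)) borel (\<lambda>p. u i p * cnj (u j p))"
    if ij: "i \<in> fresh l k" "j \<in> fresh l k" for i j
  proof -
    note em[measurable]
    have f: "(\<lambda>\<xi>. ?e i \<xi> * cnj (?e j \<xi>)) \<in> borel_measurable (PiM (past S l k) (\<lambda>_. borel))" by measurable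
    have [measurable]: "(\<lambda>\<xi>. snd (\<xi> i)) \<in> borel_measurable (PiM (fresh l k) (\<lambda>_. borel :: (('c, 'u, 'm) csi \<times> complex) measure))"
      "(\<lambda>\<xi>. snd (\<xi> j)) \<in> borel_measurable (PiM (fresh l k) (\<lambda>_. borel :: (('c, 'u, 'm) csi \<times> complex) measure))"
      using ij by (auto intro!: borel_measurable_snd_borel measurable_component_singleton)
    have g: "(\<lambda>\<xi>. snd (\<xi> i) * cnj (snd (\<xi> j))) \<in> borel_measurable (PiM (fresh l k) (\<lambda>_. borel :: (('c, 'u, 'm) csi \<times> complex) measure))"
      by measurable
    show ?thesis
      using P.indep_vars_imp_indep_var_restrict[OF W _ _ past_fresh_disjoint f g] ij
      unfolding er by (simp add: u_def)
  qed
  have orth: "(\<integral>p. u i p * cnj (u j p) \<partial>P) = 0" if ij: "i \<in> fresh l k" "j \<in> fresh l k" "i \<noteq> j" for i j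
  proof -
    have g: "(\<lambda>\<xi>. snd (\<xi> i)) \<in> borel_measurable (PiM {i} (\<lambda>_. borel :: (('c, 'u, 'm) csi \<times> complex) measure))"
      "(\<lambda>\<xi>. cnj (snd (\<xi> j))) \<in> borel_measurable (PiM {j} (\<lambda>_. borel :: (('c, 'u, 'm) csi \<times> complex) measure))"
      by (auto intro!: borel_measurable_cnj borel_measurable_snd_borel measurable_component_singleton)
    have "P.indep_var borel (u i) borel (\<lambda>p. cnj (u j p))"
      using P.indep_vars_imp_indep_var_restrict[OF W _ _ _ g] ij by (simp add: u_def[abs_def])
    then have "(\<integral>p. u i p * cnj (u j p) \<partial>P) = (\<integral>p. u i p \<partial>P) * (\<integral>p. cnj (u j p) \<partial>P)"
      using ui ij by (intro P.indep_var_lebesgue_integral) auto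
    then show ?thesis using mean ij by (simp add: u_def)
  qed
  have u2': "integrable P (\<lambda>p. (norm (u j p))\<^sup>2)" if "j \<in> fresh l k" for j using u2[OF that] by (simp add: u_def)
  have fin: "finite (fresh l k :: ('c, 'u) source set)" by simp
  have Fe: "F = (\<lambda>p. (norm (\<Sum>j\<in>fresh l k. b j p * u j p))\<^sup>2)"
    unfolding F b_def u_def
    by (rule ext) (simp only: error_eq_sum[where \<xi> = "\<lambda>i. W i p" and b = "est_gain S l k (\<lambda>i. W i p)" for p])
  note os = P.integral_norm_sum_orthogonal[OF fin bm um b2 u2' ind orth]
  show "integrable P F" unfolding Fe by (rule os(1))
  have "(\<integral>p. F p \<partial>P) = (\<Sum>j\<in>fresh l k. (\<integral>p. (norm (b j p))\<^sup>2 \<partial>P) * (\<integral>p. (norm (u j p))\<^sup>2 \<partial>P))"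
    unfolding Fe by (rule os(2))
  also have "\<dots> = (\<Sum>l'\<in>UNIV. \<Sum>k'\<in>UNIV. (\<integral>p. (norm (b (Symbol 0 l' k' 1) p))\<^sup>2 \<partial>P))
      + (norm c)\<^sup>2 * (sigma2 S / eta S l k * (\<integral>\<omega>. 1 / (norm (alpha_bar S l k 0 1 \<omega>))\<^sup>2 \<partial>Om S))"
    unfolding sum_fresh bN(2) by (simp add: u_def sym noi)
  also have "(\<Sum>l'\<in>UNIV. \<Sum>k'\<in>UNIV. (\<integral>p. (norm (b (Symbol 0 l' k' 1) p))\<^sup>2 \<partial>P))
     = 1 - 2 * Re (c * m) + (norm c)\<^sup>2 * (cvar (Om S) (?A l k) + (norm m)\<^sup>2)
      + (\<Sum>k'\<in>UNIV - {k}. (norm c)\<^sup>2 * (eta S l k' / eta S l k * (\<integral>\<omega>. (norm (?A l k' \<omega>))\<^sup>2 \<partial>Om S)))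
      + (\<Sum>l'\<in>UNIV - {l}. \<Sum>k'\<in>UNIV. (norm c)\<^sup>2 * (eta S l' k' / eta S l k * (\<integral>\<omega>. (norm (?A l' k' \<omega>))\<^sup>2 \<partial>Om S)))"
    unfolding sum_split_user[of _ l k] bS(2)
    by (intro arg_cong2[where f = "(+)"] sum.cong refl bO(2)) auto
  finally show "(\<integral>p. F p \<partial>P) = 1 - 2 * Re (c * m) + (norm c)\<^sup>2 * ((norm m)\<^sup>2 + sinr_den S l k 0 1)"
    unfolding sinr_den_def sum_distrib_left[symmetric] by (simp add: algebra_simps)
qed

lemma sinr_den_nonneg: "0 < eta S l k \<Longrightarrow> 0 \<le> sinr_den S l k t n"
  unfolding sinr_den_def cvar_def using eta_range sigma2_pos
  by (intro add_nonneg_nonneg sum_nonneg mult_nonneg_nonneg divide_nonneg_nonneg integral_nonneg_AE) auto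

lemma SINR_eq: "SINR S l k t n =
    (norm (\<integral>\<omega>. alpha S t l k l k \<omega> / alpha_bar S l k t n \<omega> \<partial>Om S))\<^sup>2 / sinr_den S l k t n"
  unfolding SINR_def sinr_den_def ..

text \<open>The linear MMSE coefficient; the degenerate case of a vanishing denominator, where
  \<^const>\<open>SINR\<close> is \<open>0\<close> by convention, uses the trivial estimate.\<close>

lemma lmmse:
  assumes "0 < eta S l k"
    and m: "m = (\<integral>\<omega>. alpha S 0 l k l k \<omega> / alpha_bar S l k 0 1 \<omega> \<partial>Om S)"
  obtains c where "0 < 1 - 2 * Re (c * m) + (norm c)\<^sup>2 * ((norm m)\<^sup>2 + sinr_den S l k 0 1)"
    and "1 / (1 - 2 * Re (c * m) + (norm c)\<^sup>2 * ((norm m)\<^sup>2 + sinr_den S l k 0 1)) = 1 + SINR S l k 0 1"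
proof (cases "sinr_den S l k 0 1 = 0")
  case True
  then show ?thesis using that[of 0] by (simp add: SINR_eq)
next
  case False
  let ?v = "sinr_den S l k 0 1" let ?q = "(norm m)\<^sup>2 + ?v" let ?c = "cnj m / complex_of_real ?q"
  have v: "0 < ?v" using False sinr_den_nonneg[OF assms(1), of 0 1] by simp
  then have q: "0 < ?q" by (intro add_nonneg_pos) auto
  have "?c * m = complex_of_real ((norm m)\<^sup>2 / ?q)"
    by (simp only: times_divide_eq_left of_real_divide complex_norm_square mult.commute[of "cnj m"])
  then have r: "Re (?c * m) = (norm m)\<^sup>2 / ?q" by (simp only: Re_complex_of_real)
  have n: "(norm ?c)\<^sup>2 * ?q = (norm m)\<^sup>2 / ?q"
    using q by (simp only: norm_divide power_divide complex_mod_cnj norm_of_real power2_abs) (simp add: power2_eq_square)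
  have s: "1 - 2 * Re (?c * m) + (norm ?c)\<^sup>2 * ?q = ?v / ?q"
  proof -
    have "?v / ?q = (?q - (norm m)\<^sup>2) / ?q" by simp
    also have "\<dots> = 1 - (norm m)\<^sup>2 / ?q" unfolding diff_divide_distrib using q by simp
    finally show ?thesis unfolding r n by simp
  qed
  have "?q / ?v = 1 + SINR S l k 0 1"
    using v by (simp add: SINR_eq m[symmetric] add_divide_distrib)
  then show ?thesis using that[of ?c] v q unfolding s by simp
qed

lemma symb_square_integrable:
  "n \<in> data_idx S \<Longrightarrow> integrable (Om S) (\<lambda>\<omega>. (norm (symb S t l k n \<omega>))\<^sup>2)"
  using symb_power[of n t l k] not_integrable_integral_eq by fastforce

lemma equalizer_cong:
  "(\<And>m. m \<in> B \<Longrightarrow> y m = y' m) \<Longrightarrow> equalizer S l k B y = equalizer S l k B y'"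
  by (simp add: equalizer_def)

lemma input_law_in_input_laws:
  assumes "finite I"
  shows "PiM I (\<lambda>_. cn_law 1) \<in> input_laws I"
proof -
  let ?X = "PiM I (\<lambda>_. cn_law 1)"
  have 1: "(\<integral>\<^sup>+x. ennreal ((norm (x i))\<^sup>2) \<partial>?X) = 1" if i: "i \<in> I" for i
  proof -
    have d: "distr ?X (cn_law 1) (\<lambda>x. x i) = cn_law 1"
      using i by (intro distr_PiM_component prob_space_cn_law) auto
    have "(\<integral>\<^sup>+x. ennreal ((norm (x i))\<^sup>2) \<partial>?X) = (\<integral>\<^sup>+z. ennreal ((norm z)\<^sup>2) \<partial>distr ?X (cn_law 1) (\<lambda>x. x i))"
      using i by (subst nn_integral_distr) auto
    then show ?thesis unfolding d by (simp add: nn_integral_cn_law_power2)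
  qed
  have "(\<integral>\<^sup>+x. (\<Sum>i\<in>I. ennreal ((norm (x i))\<^sup>2)) \<partial>?X) = (\<Sum>i\<in>I. \<integral>\<^sup>+x. ennreal ((norm (x i))\<^sup>2) \<partial>?X)"
    by (intro nn_integral_sum) auto
  also have "\<dots> = of_nat (card I)" by (simp add: 1)
  finally show ?thesis
    by (auto simp: input_laws_def intro!: prob_space_PiM prob_space_cn_law sets_PiM_cong)
qed

section \<open>Coded transmission over many intervals\<close>

lemma symb_law_relabel:
  assumes "n \<in> data_idx S" "m \<in> data_idx S"
  shows "distr (Om S) borel (symb S 0 l k (swap1 n m)) = distr (Om S) borel (symb S 0 l k m)"
  using assms swap1_data_idx_iff symb_identical by blast

definition coded :: "'c \<Rightarrow> 'u \<Rightarrow> nat set \<Rightarrow> nat \<Rightarrow> ('c, 'u) source set"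
  where "coded l k A n = {Symbol 0 l k m | m. m \<in> data_idx S \<and> swap1 n m \<in> A}"

fun position :: "nat \<Rightarrow> nat \<Rightarrow> ('c, 'u) source \<Rightarrow> nat \<times> nat"
  where "position t n (Symbol _ _ _ m) = (t, swap1 n m)"
  | "position t n _ = (t, n)"

definition mixed_val ::
    "'c \<Rightarrow> 'u \<Rightarrow> nat set \<Rightarrow> nat \<Rightarrow> nat \<Rightarrow> ('c, 'u) source \<Rightarrow> (nat \<times> nat \<Rightarrow> complex) \<times> 'w \<Rightarrow> ('c, 'u, 'm) csi \<times> complex"
  where "mixed_val l k A t n i p =
    (if i \<in> coded l k A n then (0, fst p (position t n i)) else source_val S (relabel t n i) (snd p))"

lemma coded_subset: "coded l k A n \<subseteq> past S l k \<union> fresh l k"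
  by (auto simp: coded_def past_def sample_sources_def image_iff)

lemma sample_mixed_val:
  assumes "m \<in> data_idx S"
  shows "sample S l k m (\<lambda>i. mixed_val l k A t n i p) = y_input S l k A (fst p) (t, swap1 n m) (snd p)"
proof -
  have "Symbol 0 l' k' m \<in> coded l k A n \<longleftrightarrow> l' = l \<and> k' = k \<and> swap1 n m \<in> A" for l' k'
    using assms by (auto simp: coded_def)
  moreover have "Channel 0 \<notin> coded l k A n" "Noise 0 l k m \<notin> coded l k A n" by (auto simp: coded_def)
  ultimately show ?thesis
    unfolding sample_def y_input_def received_def prod.case mixed_val_def
    by (auto simp: alpha_eq_gain intro!: sum.cong)
qed

lemma indep_vars_mixed_val:
  fixes I :: "(nat \<times> nat) set"
  defines "\<mu> \<equiv> PiM I (\<lambda>_. cn_law 1)"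
  assumes n: "n \<in> A" and A: "A \<subseteq> data_idx S" and I: "{t} \<times> A \<subseteq> I"
  shows "prob_space.indep_vars (\<mu> \<Otimes>\<^sub>M Om S) (\<lambda>_. borel) (mixed_val l k A t n) (past S l k \<union> fresh l k)"
    and "i \<in> coded l k A n \<Longrightarrow> distr (\<mu> \<Otimes>\<^sub>M Om S) borel (mixed_val l k A t n i) = distr (cn_law 1) borel (Pair 0)"
    and "i \<in> past S l k \<union> fresh l k - coded l k A n \<Longrightarrow>
      distr (\<mu> \<Otimes>\<^sub>M Om S) borel (mixed_val l k A t n i) = distr (Om S) borel (source_val S i)"
proof -
  let ?K = "past S l k \<union> fresh l k" let ?C = "coded l k A n"
  let ?X = "\<lambda>i x. (0 :: ('c, 'u, 'm) csi, x (position t n i))"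
  have nD: "n \<in> data_idx S" using n A by auto
  have \<mu>: "prob_space \<mu>" unfolding \<mu>_def by (intro prob_space_PiM prob_space_cn_law) simp
  interpret \<mu>: prob_space \<mu> by fact
  have inj: "inj_on (position t n) ?C"
    using inj_swap1[of n] by (auto simp: coded_def inj_on_def)
  have pos: "position t n ` ?C \<subseteq> I"
    using I by (auto simp: coded_def)
  have ne: "Symbol 0 l k 1 \<in> ?C" using n one_data_idx by (auto simp: coded_def)
  have pm: "Pair (0 :: ('c, 'u, 'm) csi) \<in> measurable (cn_law 1) borel"
    by (simp add: measurable_cong_sets[OF sets_cn_law refl] borel_measurable_Pair)
  have "\<mu>.indep_vars (\<lambda>_. cn_law 1) (\<lambda>i x. x (position t n i)) ?C"
    unfolding \<mu>_def using ne by (intro indep_vars_PiM_reindex(1)[where K = I and M = "\<lambda>_. cn_law 1", OF _ inj pos]) (auto intro: prob_space_cn_law)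
  then have iX: "\<mu>.indep_vars (\<lambda>_. borel) ?X ?C"
    by (rule \<mu>.indep_vars_compose2[where Y = "\<lambda>_. Pair 0"]) (rule pm)
  have iY: "indep_vars (\<lambda>_. borel) (\<lambda>i. source_val S (relabel t n i)) (?K - ?C)"
    by (rule indep_vars_relabel[OF nD]) auto
  have "Channel 0 \<in> ?K - ?C" by (auto simp: past_def coded_def)
  then have ne2: "?K - ?C \<noteq> {}" by blast
  have fin: "finite ?K" by simp
  have finC: "finite ?C" using coded_subset fin by (rule finite_subset)
  note pp = indep_vars_pair_measure[OF \<mu> prob_space_axioms iX iY finC _ _ ne2]
  have un: "?C \<union> (?K - ?C) = ?K" using coded_subset[of l k A n] by blast
  show "prob_space.indep_vars (\<mu> \<Otimes>\<^sub>M Om S) (\<lambda>_. borel) (mixed_val l k A t n) ?K"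
    using pp(1) ne fin unfolding un mixed_val_def[abs_def] by auto
  show "distr (\<mu> \<Otimes>\<^sub>M Om S) borel (mixed_val l k A t n i) = distr (cn_law 1) borel (Pair 0)" if i: "i \<in> ?C" for i
  proof -
    have pi: "position t n i \<in> I" using pos i by blast
    have "distr (\<mu> \<Otimes>\<^sub>M Om S) borel (mixed_val l k A t n i) = distr \<mu> borel (?X i)"
      using pp(2)[of i] i ne fin by (auto simp: mixed_val_def[abs_def])
    also have "\<dots> = distr (distr \<mu> (cn_law 1) (\<lambda>x. x (position t n i))) borel (Pair 0)"
      using pi by (subst distr_distr[OF pm]) (auto simp: \<mu>_def o_def)
    also have "distr \<mu> (cn_law 1) (\<lambda>x. x (position t n i)) = cn_law 1"
      unfolding \<mu>_def using pi by (intro distr_PiM_component prob_space_cn_law) auto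
    finally show ?thesis .
  qed
  show "distr (\<mu> \<Otimes>\<^sub>M Om S) borel (mixed_val l k A t n i) = distr (Om S) borel (source_val S i)" if i: "i \<in> ?K - ?C" for i
  proof -
    have "distr (\<mu> \<Otimes>\<^sub>M Om S) borel (mixed_val l k A t n i) = distr (Om S) borel (source_val S (relabel t n i))"
      using pp(3)[of i] i ne fin by (auto simp: mixed_val_def[abs_def])
    then show ?thesis using distr_source_val_relabel[OF nD, of i l k t] i by simp
  qed
qed

lemma y_input_measurable:
  assumes m: "m \<in> data_idx S" and I: "{t} \<times> A \<subseteq> I"
  shows "(\<lambda>p. y_input S l k A (fst p) (t, m) (snd p)) \<in> borel_measurable (PiM I (\<lambda>_. cn_law 1) \<Otimes>\<^sub>M Om S)"
proof -
  let ?P = "PiM I (\<lambda>_. cn_law 1) \<Otimes>\<^sub>M Om S"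
  have [measurable]: "(\<lambda>p. alpha S t l k l' k' (snd p)) \<in> borel_measurable ?P" for l' k'
    by (rule measurable_compose[OF measurable_snd alpha_measurable])
  have [measurable]: "(\<lambda>p. noise S t l k m (snd p)) \<in> borel_measurable ?P"
    by (rule measurable_compose[OF measurable_snd noise_measurable[OF m]])
  have [measurable]: "(\<lambda>p. if l' = l \<and> k' = k \<and> m \<in> A then fst p (t, m) else symb S t l' k' m (snd p)) \<in> borel_measurable ?P" for l' k'
  proof (cases "l' = l \<and> k' = k \<and> m \<in> A")
    case True
    then have "(t, m) \<in> I" using I by auto
    then have "(\<lambda>p. fst p (t, m)) \<in> measurable ?P (cn_law 1)" by auto
    then show ?thesis using True by (simp add: measurable_cong_sets[OF refl sets_cn_law])
  next
    case False
    then show ?thesis using measurable_compose[OF measurable_snd symb_measurable[OF m]] by auto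
  qed
  show ?thesis unfolding y_input_def received_def prod.case by measurable
qed

lemma ergodic_capacity_ge:
  assumes eta: "0 < eta S l k" and A: "A \<subseteq> data_idx S"
    and gauss: "\<And>n. n \<in> A \<Longrightarrow> A = {n} \<or> distr (Om S) borel (symb S 0 l k n) = cn_law 1"
    and n0: "n0 \<in> data_idx S"
  shows "ereal (real (card A) / real (tauc S) * log 2 (1 + SINR S l k t0 n0)) \<le> ergodic_capacity S l k A"
proof -
  let ?D = "data_idx S"
  have finD: "finite ?D" by (simp add: data_idx_def)
  then have finA: "finite A" using A finite_subset by blast
  define m where "m = (\<integral>\<omega>. alpha S 0 l k l k \<omega> / alpha_bar S l k 0 1 \<omega> \<partial>Om S)"
  obtain c where c: "0 < 1 - 2 * Re (c * m) + (norm c)\<^sup>2 * ((norm m)\<^sup>2 + sinr_den S l k 0 1)"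
    "1 / (1 - 2 * Re (c * m) + (norm c)\<^sup>2 * ((norm m)\<^sup>2 + sinr_den S l k 0 1)) = 1 + SINR S l k 0 1"
    by (rule lmmse[OF eta m_def])
  let ?s = "1 - 2 * Re (c * m) + (norm c)\<^sup>2 * ((norm m)\<^sup>2 + sinr_den S l k 0 1)"
  have mi: "ereal (real N * (real (card A) * log 2 (1 + SINR S l k 0 1)))
      \<le> mutual_info (PiM ({..<N} \<times> A) (\<lambda>_. cn_law 1) \<Otimes>\<^sub>M Om S) (signals ({..<N} \<times> A)) (signals ({..<N} \<times> ?D))
          fst (\<lambda>(x, \<omega>). \<lambda>i\<in>{..<N} \<times> ?D. y_input S l k A x i \<omega>)" for N
  proof -
    let ?I = "{..<N} \<times> A" let ?X = "PiM ?I (\<lambda>_. cn_law 1)" let ?P = "?X \<Otimes>\<^sub>M Om S"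
    let ?Y = "\<lambda>(x, \<omega>). \<lambda>i\<in>{..<N} \<times> ?D. y_input S l k A x i \<omega>"
    interpret X: prob_space ?X by (intro prob_space_PiM prob_space_cn_law) simp
    interpret P: pair_prob_space ?X "Om S" ..
    define z where "z i y = c * (y i / (complex_of_real (sqrt (eta S l k))
        * equalizer S l k (?D - {snd i}) (\<lambda>j. y (fst i, j))))" for i and y :: "nat \<times> nat \<Rightarrow> complex"
    have Ym: "?Y \<in> measurable ?P (signals ({..<N} \<times> ?D))"
      unfolding split_beta' by (intro measurable_restrict) (auto intro!: y_input_measurable)
    have zm: "z i \<in> borel_measurable (signals ({..<N} \<times> ?D))" if i: "i \<in> ?I" for i
    proof -
      have [measurable]: "(\<lambda>y. y i) \<in> borel_measurable (signals ({..<N} \<times> ?D))"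
        using i A by (intro measurable_component_singleton) auto
      have [measurable]: "(\<lambda>y. equalizer S l k (?D - {snd i}) (\<lambda>j. y (fst i, j))) \<in> borel_measurable (signals ({..<N} \<times> ?D))"
        using i by (intro equalizer_measurable measurable_component_singleton) auto
      show ?thesis unfolding z_def by measurable
    qed
    have F: "integrable ?P (\<lambda>p. (norm (fst p i - z i (?Y p)))\<^sup>2)"
      "(\<integral>p. (norm (fst p i - z i (?Y p)))\<^sup>2 \<partial>?P) = ?s" if i: "i \<in> ?I" for i
    proof -
      obtain t n where tn: "i = (t, n)" "t < N" "n \<in> A" using i by auto
      have nD: "n \<in> ?D" using tn A by auto
      have sub: "{t} \<times> A \<subseteq> ?I" using tn by auto
      let ?W = "mixed_val l k A t n"
      note W = indep_vars_mixed_val[where l = l and k = k, OF tn(3) A sub]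
      have Wm: "?W j \<in> borel_measurable ?P" if "j \<in> past S l k \<union> fresh l k" for j
        using W(1) that by (simp add: P.indep_vars_def)
      have est: "est_gain S l k (\<lambda>j. ?W j p) = equalizer S l k (?D - {n}) (\<lambda>j. ?Y p (t, j))" for p
      proof -
        have "est_gain S l k (\<lambda>j. ?W j p) = equalizer S l k (?D - {1}) (\<lambda>m. ?Y p (t, swap1 n m))"
          using tn swap1_data_idx_iff[OF nD] by (intro equalizer_cong) (simp add: sample_mixed_val split_beta)
        then show ?thesis using equalizer_reindex[OF nD, of l k "\<lambda>j. ?Y p (t, j)"] by simp
      qed
      have x: "snd (?W (Symbol 0 l k 1) p) = fst p i" for p
        using tn one_data_idx by (simp add: mixed_val_def coded_def)
      have F: "(\<lambda>p. (norm (fst p i - z i (?Y p)))\<^sup>2) = (\<lambda>p. (norm (snd (?W (Symbol 0 l k 1) p) - c * (sample S l k 1 (\<lambda>i. ?W i p)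
        / (complex_of_real (sqrt (eta S l k)) * est_gain S l k (\<lambda>i. ?W i p)))))\<^sup>2)"
        unfolding est x sample_mixed_val[OF one_data_idx] z_def using tn nD by (simp add: split_beta)
      have law: "\<forall>j\<in>past S l k. distr ?P borel (?W j) = distr (Om S) borel (source_val S j)"
      proof
        fix j assume j: "j \<in> past S l k"
        show "distr ?P borel (?W j) = distr (Om S) borel (source_val S j)"
        proof (cases "j \<in> coded l k A n")
          case True
          then obtain q where q: "j = Symbol 0 l k q" "q \<in> ?D" "swap1 n q \<in> A" by (auto simp: coded_def)
          have "q \<noteq> 1" using j q by (auto simp: past_def sample_sources_def)
          then have "swap1 n q \<noteq> n" by (metis swap1_1 swap1_swap1)
          then have "distr (Om S) borel (symb S 0 l k (swap1 n q)) = cn_law 1"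
            using gauss[OF q(3)] tn(3) by auto
          then have "distr (Om S) borel (symb S 0 l k q) = cn_law 1" using symb_law_relabel[OF nD q(2)] by simp
          moreover have "Pair (0 :: ('c, 'u, 'm) csi) \<in> borel_measurable (borel :: complex measure)"
            by (intro borel_measurable_Pair) auto
          then have "distr (Om S) borel (source_val S j) = distr (distr (Om S) borel (symb S 0 l k q)) borel (Pair 0)"
            using q by (subst distr_distr) (auto simp: o_def source_val_abs intro: symb_measurable)
          ultimately show ?thesis using W(2)[OF True] by simp
        next
          case False
          then show ?thesis using W(3) j by auto
        qed
      qed
      have cnm: "integrable (cn_law v) (\<lambda>z. (norm z)\<^sup>2) \<and> (\<integral>z. z \<partial>cn_law v) = 0 \<and> (\<integral>z. (norm z)\<^sup>2 \<partial>cn_law v) = v"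
        if "0 < v" for v using that by (simp add: integral_cn_law_power2 integral_cn_law_mean)
      have fr: "\<exists>\<nu>. distr ?P borel (?W j) = distr \<nu> borel (Pair 0) \<and> sets \<nu> = sets borel \<and>
          integrable \<nu> (\<lambda>z. (norm z)\<^sup>2) \<and> (\<integral>z. z \<partial>\<nu>) = 0 \<and> (\<integral>z. (norm z)\<^sup>2 \<partial>\<nu>) = v"
        if j: "j = Symbol 0 l' k' 1 \<and> v = 1 \<or> j = Noise 0 l k 1 \<and> v = sigma2 S" for j l' k' v
      proof (cases "j \<in> coded l k A n")
        case True
        then have v: "v = 1" using j by (auto simp: coded_def)
        show ?thesis using W(2)[OF True] cnm[of 1] v by (intro exI[of _ "cn_law 1"]) simp
      next
        case False
        have P: "Pair (0 :: ('c, 'u, 'm) csi) \<in> borel_measurable (borel :: complex measure)"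
          by (intro borel_measurable_Pair) auto
        have jf: "j \<in> fresh l k" using j by (auto simp: sample_sources_def image_iff)
        then have d: "distr ?P borel (?W j) = distr (Om S) borel (source_val S j)" using W(3) False by auto
        show ?thesis
          using j
        proof
          assume j: "j = Symbol 0 l' k' 1 \<and> v = 1"
          note sm = symb_measurable[OF one_data_idx, of 0 l' k']
          let ?\<nu> = "distr (Om S) borel (symb S 0 l' k' 1)"
          have "distr (Om S) borel (source_val S j) = distr ?\<nu> borel (Pair 0)"
            using j by (subst distr_distr[OF P sm]) (simp add: o_def source_val_abs)
          then show ?thesis
            using d j one_data_idx
            by (intro exI[of _ ?\<nu>]) (simp add: integrable_distr_eq[OF sm] integral_distr[OF sm] symb_square_integrable symb_mean symb_power)
        next
          assume j: "j = Noise 0 l k 1 \<and> v = sigma2 S"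
          note nm = noise_measurable[OF one_data_idx, of 0 l k]
          have "distr (Om S) borel (source_val S j) = distr (distr (Om S) borel (noise S 0 l k 1)) borel (Pair 0)"
            using j by (subst distr_distr[OF P nm]) (simp add: o_def source_val_abs)
          then show ?thesis
            using d j cnm[OF sigma2_pos] noise_law[OF one_data_idx] by (intro exI[of _ "cn_law (sigma2 S)"]) simp
        qed
      qed
      have mom: "integrable ?P (\<lambda>p. (norm (snd (?W j p)))\<^sup>2) \<and> (\<integral>p. snd (?W j p) \<partial>?P) = 0
          \<and> (\<integral>p. (norm (snd (?W j p)))\<^sup>2 \<partial>?P) = v"
        if j: "j = Symbol 0 l' k' 1 \<and> v = 1 \<or> j = Noise 0 l k 1 \<and> v = sigma2 S" for j l' k' v
      proof -
        obtain \<nu> where \<nu>: "distr ?P borel (?W j) = distr \<nu> borel (Pair 0)" "sets \<nu> = sets borel"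
          "integrable \<nu> (\<lambda>z. (norm z)\<^sup>2)" "(\<integral>z. z \<partial>\<nu>) = 0" "(\<integral>z. (norm z)\<^sup>2 \<partial>\<nu>) = v"
          using fr[OF j] by blast
        have "j \<in> past S l k \<union> fresh l k" using j by (auto simp: sample_sources_def image_iff)
        note M = distr_Pair_moments[OF Wm[OF this] \<nu>(1,2)]
        show ?thesis
          using M(1)[of "\<lambda>z. z"] M[of "\<lambda>z. (norm z)\<^sup>2"] \<nu>(3-5) by simp
      qed
      have frj: "(\<exists>l' k'. j = Symbol 0 l' k' 1) \<or> j = Noise 0 l k 1" if "j \<in> fresh l k" for j
        using that by (auto simp: sample_sources_def)
      have f1: "integrable ?P (\<lambda>p. (norm (snd (?W j p)))\<^sup>2)" and f2: "(\<integral>p. snd (?W j p) \<partial>?P) = 0"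
        if "j \<in> fresh l k" for j
        using frj[OF that] mom[of j _ _ 1] mom[of j _ _ "sigma2 S"] by auto
      have f3: "(\<integral>p. (norm (snd (?W (Symbol 0 l' k' 1) p)))\<^sup>2 \<partial>?P) = 1" for l' k'
        using mom[of "Symbol 0 l' k' 1" l' k' 1] by simp
      have f4: "(\<integral>p. (norm (snd (?W (Noise 0 l k 1) p)))\<^sup>2 \<partial>?P) = sigma2 S"
        using mom[of "Noise 0 l k 1" _ _ "sigma2 S"] by simp
      show "integrable ?P (\<lambda>p. (norm (fst p i - z i (?Y p)))\<^sup>2)"
        by (rule error_second_moment(1)[OF eta P.prob_space_axioms W(1) law _ _ f3 f4 m_def F]) (erule f1 f2)+
      show "(\<integral>p. (norm (fst p i - z i (?Y p)))\<^sup>2 \<partial>?P) = ?s"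
        by (rule error_second_moment(2)[OF eta P.prob_space_axioms W(1) law _ _ f3 f4 m_def F]) (erule f1 f2)+
    qed
    have "ereal (real (card ?I) * log 2 (1 / ?s))
      \<le> mutual_info ?P (signals ?I) (signals ({..<N} \<times> ?D)) fst ?Y"
      using finA by (intro mutual_info_cn_input_ge[where z = z] prob_space_axioms c(1) Ym zm F) auto
    then show ?thesis unfolding c(2) by (simp add: card_cartesian_product mult.assoc)
  qed
  have "ereal (real (card A) / real (tauc S) * log 2 (1 + SINR S l k 0 1)) \<le> ergodic_capacity S l k A"
    unfolding ergodic_capacity_def
  proof (intro Liminf_bounded eventually_sequentiallyI[of 1])
    fix N :: nat assume N: "1 \<le> N"
    let ?SUP = "SUP \<mu>\<in>input_laws ({..<N} \<times> A).
        mutual_info (\<mu> \<Otimes>\<^sub>M Om S) (signals ({..<N} \<times> A)) (signals ({..<N} \<times> ?D))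
          fst (\<lambda>(x, \<omega>). \<lambda>i\<in>{..<N} \<times> ?D. y_input S l k A x i \<omega>)"
    have le: "ereal (real N * (real (card A) * log 2 (1 + SINR S l k 0 1))) \<le> ?SUP"
      by (rule SUP_upper2[OF input_law_in_input_laws], use finA in simp, rule mi)
    have "ereal (real (card A) / real (tauc S) * log 2 (1 + SINR S l k 0 1))
      = ereal (1 / (real N * real (tauc S))) * ereal (real N * (real (card A) * log 2 (1 + SINR S l k 0 1)))"
      using N by simp
    also have "\<dots> \<le> ereal (1 / (real N * real (tauc S))) * ?SUP"
      by (intro ereal_mult_left_mono le) simp
    finally show "ereal (real (card A) / real (tauc S) * log 2 (1 + SINR S l k 0 1))
      \<le> ereal (1 / (real N * real (tauc S))) * ?SUP" .
  qed
  then show ?thesis by (simp add: SINR_0_1[OF n0])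
qed

end

theorem lemma6:
  fixes S :: "('w, 'c::finite, 'u::finite, 'm::finite) downlink"
    and l :: 'c and k :: 'u and t n :: nat
  assumes "mimo_downlink S"
    and "0 < eta S l k"
    and "n \<in> data_idx S"
  shows "ereal (SE S l k t n) \<le> (\<Sum>n'\<in>data_idx S. ergodic_capacity S l k {n'}) \<and>
    ((\<forall>t'. \<forall>n'\<in>data_idx S. distr (Om S) borel (symb S t' l k n') = cn_law 1) \<longrightarrow>
      ereal (SE S l k t n) \<le> ergodic_capacity S l k (data_idx S))"
proof -
  interpret mimo_downlink S by fact
  let ?D = "data_idx S" let ?r = "log 2 (1 + SINR S l k t n)"
  have "real (card ?D) / real (tauc S) = 1 - real (taup S) / real (tauc S)"
    using tau by (simp add: data_idx_def of_nat_diff diff_divide_distrib)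
  then have SE: "SE S l k t n = real (card ?D) / real (tauc S) * ?r" by (simp add: SE_def)
  have "ereal (SE S l k t n) = (\<Sum>n'\<in>?D. ereal (real (card {n'}) / real (tauc S) * ?r))"
    by (simp add: SE)
  also have "\<dots> \<le> (\<Sum>n'\<in>?D. ergodic_capacity S l k {n'})"
    using assms by (intro sum_mono ergodic_capacity_ge) auto
  finally have 1: "ereal (SE S l k t n) \<le> (\<Sum>n'\<in>?D. ergodic_capacity S l k {n'})" .
  have "ereal (SE S l k t n) \<le> ergodic_capacity S l k ?D"
    if "\<forall>t'. \<forall>n'\<in>?D. distr (Om S) borel (symb S t' l k n') = cn_law 1"
    unfolding SE using assms that by (intro ergodic_capacity_ge) auto
  with 1 show ?thesis by blast
qed

end
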